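(* Let $G$ be a connected graph with $V(G)=[n]$. Then the following hold: (a) Let $G$ be a labeled Hamiltonian graph. Then $I_G$ is an almost complete intersection if and only if $G=C_n$. (b) Let $G$ be a labeled semi-Hamiltonian graph. Then $I_G$ is an almost complete intersection if and only if $G$ is a unicyclic graph obtained from $L_n$ by adding the edge $\{t,t+s\}$ for some $t,s$ with $1\leq t\leq n-2$ and $s\geq 2$.
   Context: All graphs are finite and simple. Let $\mathbb{K}$ be a field, $[n]=\{1,\ldots,n\}$ and $S=\mathbb{K}[x_1,\ldots,x_{n+1}]$. For $1\le i<j\le n$ put $g_{ij}=x_ix_{j+1}-x_jx_{i+1}$. For a graph $G$ with vertex set $[n]$, the Hankel edge ideal $I_G\subset S$ is the ideal generated by the $g_{ij}$ with $i<j$ and $\{i,j\}\in E(G)$. $L_n$ is the path with vertex set $[n]$ and edges $\{i,i+1\}$, $1\le i\le n-1$. $C_n$ is the cycle with vertex set $[n]$ and edges $\{1,n\}$ and $\{i,i+1\}$, $1\le i\le n-1$ (a cycle has at least $3$ vertices). A graph $G$ on $[n]$ is a labeled Hamiltonian graph if $C_n$ is a subgraph of $G$; it is a labeled semi-Hamiltonian graph if $L_n$ is a subgraph of $G$ and $\{1,n\}\notin E(G)$. A graph is unicyclic if it contains exactly one cycle. For a homogeneous ideal $I\subset S$, $\mu(I)$ is the cardinality of a minimal homogeneous generating set of $I$, and $I$ is an almost complete intersection if $\mu(I)=\operatorname{height} I+1$. *)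

theory Defs
  imports "HOL-Algebra.Ideal" "HOL-Library.Poly_Mapping" "HOL-Library.Extended_Nat"
begin

section \<open>Finite simple graphs\<close>

type_synonym 'a graph = "'a set \<times> 'a set set"

abbreviation verts :: "'a graph \<Rightarrow> 'a set" where "verts \<equiv> fst"
abbreviation edges :: "'a graph \<Rightarrow> 'a set set" where "edges \<equiv> snd"

definition simple_graph :: "'a graph \<Rightarrow> bool" where
  "simple_graph G \<longleftrightarrow> finite (verts G) \<and>
     (\<forall>e \<in> edges G. \<exists>u v. u \<in> verts G \<and> v \<in> verts G \<and> u \<noteq> v \<and> e = {u, v})"

definition subgraph :: "'a graph \<Rightarrow> 'a graph \<Rightarrow> bool" where
  "subgraph H G \<longleftrightarrow> verts H \<subseteq> verts G \<and> edges H \<subseteq> edges G"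

definition connected_graph :: "'a graph \<Rightarrow> bool" where
  "connected_graph G \<longleftrightarrow> verts G \<noteq> {} \<and>
     (\<forall>u \<in> verts G. \<forall>v \<in> verts G. (u, v) \<in> {(a, b). {a, b} \<in> edges G}\<^sup>*)"

definition is_cycle :: "'a graph \<Rightarrow> bool" where
  "is_cycle C \<longleftrightarrow> (\<exists>vs. distinct vs \<and> 3 \<le> length vs \<and>
     C = (set vs, {{vs ! i, vs ! (Suc i mod length vs)} | i. i < length vs}))"

text \<open>Cycles are counted as subgraphs, so rotating or reversing a closed walk does
  not produce a new cycle.\<close>

definition unicyclic :: "'a graph \<Rightarrow> bool" where
  "unicyclic G \<longleftrightarrow> (\<exists>!C. is_cycle C \<and> subgraph C G)"

definition path_graph :: "nat \<Rightarrow> nat graph" where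
  "path_graph n = ({1..n}, {{i, i + 1} | i. 1 \<le> i \<and> i < n})"

definition cycle_graph :: "nat \<Rightarrow> nat graph" where
  "cycle_graph n = ({1..n}, insert {1, n} {{i, i + 1} | i. 1 \<le> i \<and> i < n})"

text \<open>The bound \<open>3 \<le> n\<close> is needed: \<open>cycle_graph n\<close> is a cycle only for these \<open>n\<close>
  (for \<open>n = 2\<close> the formula gives a single edge).\<close>

definition labeled_hamiltonian :: "nat \<Rightarrow> nat graph \<Rightarrow> bool" where
  "labeled_hamiltonian n G \<longleftrightarrow> 3 \<le> n \<and> subgraph (cycle_graph n) G"

definition labeled_semi_hamiltonian :: "nat \<Rightarrow> nat graph \<Rightarrow> bool" where
  "labeled_semi_hamiltonian n G \<longleftrightarrow> subgraph (path_graph n) G \<and> {1, n} \<notin> edges G"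


section \<open>Polynomial rings\<close>

text \<open>A monomial is its finitely supported exponent function \<open>nat \<Rightarrow>\<^sub>0 nat\<close>, where the
  exponent of \<open>x\<^sub>i\<close> is the value at \<open>i\<close>. The type \<open>'k mpoly\<close> has infinitely many
  variables; \<open>mpoly_ring V\<close> is its subring \<open>k[x\<^sub>i | i \<in> V]\<close>.\<close>

type_synonym 'k mpoly = "(nat \<Rightarrow>\<^sub>0 nat) \<Rightarrow>\<^sub>0 'k"

definition mpoly_ring :: "nat set \<Rightarrow> ('k::comm_ring_1) mpoly ring" where
  "mpoly_ring V = \<lparr>carrier = {p. \<forall>m \<in> Poly_Mapping.keys p. Poly_Mapping.keys m \<subseteq> V},
     mult = (*), one = 1, zero = 0, add = (+)\<rparr>"

definition Var :: "nat \<Rightarrow> ('k::comm_ring_1) mpoly" where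
  "Var i = Poly_Mapping.single (Poly_Mapping.single i 1) 1"

definition monom_degree :: "(nat \<Rightarrow>\<^sub>0 nat) \<Rightarrow> nat" where
  "monom_degree m = (\<Sum>i \<in> Poly_Mapping.keys m. Poly_Mapping.lookup m i)"

definition homogeneous :: "('k::comm_ring_1) mpoly \<Rightarrow> bool" where
  "homogeneous p \<longleftrightarrow> (\<exists>d. \<forall>m \<in> Poly_Mapping.keys p. monom_degree m = d)"

lemma mpoly_ring_cring: "cring (mpoly_ring V :: ('k::comm_ring_1) mpoly ring)"
proof -
  let ?R = "mpoly_ring V :: 'k mpoly ring"
  have m: "p * q \<in> carrier ?R" if p: "p \<in> carrier ?R" and q: "q \<in> carrier ?R" for p q
  proof -
    have "Poly_Mapping.keys m \<subseteq> V" if mem: "m \<in> Poly_Mapping.keys (p * q)" for m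
    proof -
      obtain a b where ab: "m = a + b" "a \<in> Poly_Mapping.keys p" "b \<in> Poly_Mapping.keys q"
        using mem keys_mult[of p q] by blast
      have "Poly_Mapping.keys a \<subseteq> V" "Poly_Mapping.keys b \<subseteq> V"
        using p q ab by (simp_all add: mpoly_ring_def)
      thus ?thesis
        using Poly_Mapping.keys_add[of a b] ab(1) by blast
    qed
    thus ?thesis by (simp add: mpoly_ring_def)
  qed
  have a: "p + q \<in> carrier ?R" if p: "p \<in> carrier ?R" and q: "q \<in> carrier ?R" for p q
    using p q Poly_Mapping.keys_add[of p q] unfolding mpoly_ring_def partial_object.simps by blast
  have u: "- p \<in> carrier ?R" if "p \<in> carrier ?R" for p
    using that by (simp add: mpoly_ring_def)
  have z: "0 \<in> carrier ?R" and o: "1 \<in> carrier ?R"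
    by (simp_all add: mpoly_ring_def)
  have ops: "mult ?R = (*)" "one ?R = 1" "zero ?R = 0" "add ?R = (+)"
    by (simp_all add: mpoly_ring_def)
  show ?thesis
  proof (rule cringI)
    show "abelian_group ?R"
    proof (rule abelian_groupI)
      fix x assume "x \<in> carrier ?R"
      thus "\<exists>y\<in>carrier ?R. y \<oplus>\<^bsub>?R\<^esub> x = \<zero>\<^bsub>?R\<^esub>"
        using u[of x] by (intro bexI[of _ "- x"]) (simp_all add: ops)
    qed (simp_all add: ops a z add.assoc add.commute)
    show "Group.comm_monoid ?R"
      by (rule comm_monoidI) (simp_all add: ops m o mult.assoc mult.commute)
  qed (simp add: ops distrib_right)
qed


section \<open>Height, number of generators, almost complete intersections\<close>

definition prime_height :: "('a, 'b) ring_scheme \<Rightarrow> 'a set \<Rightarrow> enat" where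
  "prime_height R P = Sup {enat k | k. \<exists>c :: nat \<Rightarrow> 'a set.
     (\<forall>i \<le> k. primeideal (c i) R) \<and> (\<forall>i < k. c i \<subset> c (Suc i)) \<and> c k = P}"

definition ideal_height :: "('a, 'b) ring_scheme \<Rightarrow> 'a set \<Rightarrow> enat" where
  "ideal_height R I = Inf {prime_height R P | P. primeideal P R \<and> I \<subseteq> P}"

definition minimal_homogeneous_gens ::
    "('k::comm_ring_1) mpoly ring \<Rightarrow> 'k mpoly set \<Rightarrow> 'k mpoly set \<Rightarrow> bool" where
  "minimal_homogeneous_gens R I B \<longleftrightarrow> finite B \<and> B \<subseteq> carrier R \<and> (\<forall>b \<in> B. homogeneous b) \<and>
     Idl\<^bsub>R\<^esub> B = I \<and> (\<forall>C. C \<subset> B \<longrightarrow> Idl\<^bsub>R\<^esub> C \<noteq> I)"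

text \<open>For a homogeneous ideal of \<open>k[x\<^sub>i | i \<in> V]\<close>, with \<open>k\<close> a field and \<open>V\<close> finite, all
  minimal homogeneous generating sets have the same cardinality (graded Nakayama lemma).
  For other arguments the value is irrelevant.\<close>

definition num_min_gens :: "('k::comm_ring_1) mpoly ring \<Rightarrow> 'k mpoly set \<Rightarrow> nat" where
  "num_min_gens R I = (THE k. \<exists>B. minimal_homogeneous_gens R I B \<and> card B = k)"

definition almost_complete_intersection ::
    "('k::comm_ring_1) mpoly ring \<Rightarrow> 'k mpoly set \<Rightarrow> bool" where
  "almost_complete_intersection R I \<longleftrightarrow> enat (num_min_gens R I) = ideal_height R I + 1"


section \<open>Hankel edge ideals\<close>

definition hankel_ring :: "nat \<Rightarrow> ('k::comm_ring_1) mpoly ring" where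
  "hankel_ring n = mpoly_ring {1..n + 1}"

definition hankel_minor :: "nat \<Rightarrow> nat \<Rightarrow> ('k::comm_ring_1) mpoly" where
  "hankel_minor i j = Var i * Var (j + 1) - Var j * Var (i + 1)"

text \<open>Here \<open>G\<close> is meant to have vertex set \<open>{1..n}\<close>.\<close>

definition hankel_edge_ideal :: "nat \<Rightarrow> nat graph \<Rightarrow> ('k::comm_ring_1) mpoly set" where
  "hankel_edge_ideal n G =
     Idl\<^bsub>hankel_ring n\<^esub> {hankel_minor i j | i j. i < j \<and> {i, j} \<in> edges G}"

end

theory Submission
  imports Defs "HOL-Algebra.Ring_Divisibility"
begin

text \<open>If \<open>G\<close> contains the path \<open>L\<^sub>n\<close>, then \<open>I\<^sub>G\<close> has height \<open>n - 1\<close>; since the minors \<open>g\<^sub>i\<^sub>j\<close> are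
  linearly independent quadrics, \<open>\<mu>(I\<^sub>G)\<close> is the number of edges, and both equivalences become
  statements about graphs with exactly \<open>n\<close> edges.

  Lower bound on the height: the minors of the edges of \<open>L\<^sub>n\<close> form a regular sequence
  \<open>f\<^sub>1, f\<^sub>2, \<dots>\<close>. A prime \<open>P\<close> containing \<open>f\<^sub>1, \<dots>, f\<^sub>r\<close> therefore contains a prime over
  \<open>(f\<^sub>1, \<dots>, f\<^sub>r\<^sub>-\<^sub>1)\<close> that avoids \<open>f\<^sub>r\<close>, because no \<open>s f\<^sub>r\<^sup>e\<close> with \<open>s \<notin> P\<close> lies in that ideal.

  Upper bound: \<open>I\<^sub>G\<close> is contained in the prime of the cone over the rational normal curve. Its
  Hilbert function has quadratic growth, each strict step down in a chain of primes raises the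
  order of growth by one, and in \<open>n + 1\<close> variables the order is at most \<open>n + 1\<close>.\<close>

section \<open>Ideals of polynomial rings\<close>

text \<open>The lower bound concerns every prime over I_G, the upper bound only one of them, but all
  chains below it. For such chains an invariant that gains at each strict inclusion suffices. If f
  lies in Q but not in P, then multiplication by f is injective modulo P with image in Q, so a
  family independent modulo Q and the f-multiples of a family independent modulo P can be united;
  accumulating these by Pascal's rule raises the order of growth. The value n - 1 is n + 1 variables
  minus the order 2 of the cone. The obstacle in the lower bound is that each minor is linear in its
  new variable with a coefficient that can be a zero divisor: x_3 is one modulo x_1 x_3 - x_2^2 and
  x_2 x_4 - x_3^2, because (x_2, x_3) is a minimal prime over these two. Regularity is therefore
  tested on the other term, modulo the new variable, where only the square of the preceding variable
  is left.\<close>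

abbreviation polys :: "nat set \<Rightarrow> ('k::comm_ring_1) mpoly set" where
  "polys V \<equiv> carrier (mpoly_ring V)"

lemma polys_iff: "p \<in> polys V \<longleftrightarrow> (\<forall>m \<in> Poly_Mapping.keys p. Poly_Mapping.keys m \<subseteq> V)"
  by (simp add: mpoly_ring_def)

lemma mpoly_ring_simps [simp]:
  "monoid.mult (mpoly_ring V) = (*)" "monoid.one (mpoly_ring V) = 1"
  "ring.zero (mpoly_ring V) = 0" "ring.add (mpoly_ring V) = (+)"
  by (simp_all add: mpoly_ring_def)

lemma polys_zero [simp]: "0 \<in> polys V" and polys_one [simp]: "1 \<in> polys V"
  by (simp_all add: polys_iff)

lemma polys_add: "p \<in> polys V \<Longrightarrow> q \<in> polys V \<Longrightarrow> p + q \<in> polys V"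
  using Poly_Mapping.keys_add[of p q] by (auto simp: polys_iff)

lemma polys_uminus: "p \<in> polys V \<Longrightarrow> - p \<in> polys V"
  by (simp add: polys_iff)

lemma polys_diff: "p \<in> polys V \<Longrightarrow> q \<in> polys V \<Longrightarrow> p - q \<in> polys V"
  using polys_add[of p V "- q"] polys_uminus[of q V] by simp

lemma polys_mult:
  fixes p q :: "('k::comm_ring_1) mpoly"
  shows "p \<in> polys V \<Longrightarrow> q \<in> polys V \<Longrightarrow> p * q \<in> polys V"
  using monoid.m_closed[OF comm_monoid.axioms(1)[OF cring.axioms(2)[OF mpoly_ring_cring]], of p V q]
  by simp

lemma polys_power: "(p :: ('k::comm_ring_1) mpoly) \<in> polys V \<Longrightarrow> p ^ m \<in> polys V"
  by (induction m) (auto intro: polys_mult)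

lemma polys_sum: "(\<And>i. i \<in> A \<Longrightarrow> f i \<in> polys V) \<Longrightarrow> sum f A \<in> polys V"
  by (induction A rule: infinite_finite_induct) (auto intro: polys_add)

lemma polys_single: "Poly_Mapping.keys m \<subseteq> V \<Longrightarrow> Poly_Mapping.single m c \<in> polys V"
  by (simp add: polys_iff)

lemma polys_Var: "i \<in> V \<Longrightarrow> Var i \<in> polys V"
  unfolding Var_def by (rule polys_single) simp

lemmas polys_intros = polys_add polys_diff polys_uminus polys_mult polys_power polys_sum polys_Var

text \<open>Lets all later proofs work with the operations of the polynomial type. Additive inverses
  are multiples by -1, so the absorption property supplies them.\<close>

lemma ideal_mpoly_ring_iff:
  fixes I :: "('k::comm_ring_1) mpoly set"
  shows "ideal I (mpoly_ring V) \<longleftrightarrow>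
    I \<subseteq> polys V \<and> 0 \<in> I \<and> (\<forall>a\<in>I. \<forall>b\<in>I. a + b \<in> I) \<and> (\<forall>a\<in>I. \<forall>r\<in>polys V. r * a \<in> I)"
    (is "?L \<longleftrightarrow> ?R")
proof
  assume ?L
  then interpret ideal I "mpoly_ring V" .
  show ?R
    using a_subset additive_subgroup.zero_closed[OF additive_subgroup_axioms]
      additive_subgroup.a_closed[OF additive_subgroup_axioms] I_l_closed by simp
next
  assume R: ?R
  interpret cring "mpoly_ring V :: 'k mpoly ring" by (rule mpoly_ring_cring)
  have neg: "- a \<in> I" if "a \<in> I" for a
    using R that polys_uminus[OF polys_one, of V] by (metis mult_minus1)
  have inv: "\<ominus>\<^bsub>mpoly_ring V\<^esub> a = - a" if "a \<in> polys V" for a :: "'k mpoly"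
    using minus_equality[of "- a" a] that polys_uminus[OF that] by simp
  show ?L
  proof (rule idealI)
    show "subgroup I (add_monoid (mpoly_ring V))"
      by (rule add.subgroupI) (use R neg inv in \<open>auto simp: subset_iff\<close>)
  qed (use R ring_axioms in \<open>auto simp: mult.commute\<close>)
qed

lemma primeideal_mpoly_ring_iff:
  fixes I :: "('k::comm_ring_1) mpoly set"
  shows "primeideal I (mpoly_ring V) \<longleftrightarrow>
    ideal I (mpoly_ring V) \<and> 1 \<notin> I \<and>
    (\<forall>a\<in>polys V. \<forall>b\<in>polys V. a * b \<in> I \<longrightarrow> a \<in> I \<or> b \<in> I)"
    (is "?L \<longleftrightarrow> ?R")
proof
  assume ?L
  then interpret primeideal I "mpoly_ring V" .
  show ?R
    using I_prime I_notcarr one_imp_carrier is_ideal by auto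
next
  assume R: ?R
  show ?L
    by (rule primeidealI) (use R polys_one in \<open>auto simp: mpoly_ring_cring\<close>)
qed

lemma ideal_diffI:
  fixes I :: "('k::comm_ring_1) mpoly set"
  assumes I: "ideal I (mpoly_ring V)" and "a \<in> I" "b \<in> I"
  shows "a - b \<in> I"
proof -
  have "(- 1) * b \<in> I"
    using assms polys_uminus[OF polys_one, of V] unfolding ideal_mpoly_ring_iff by blast
  thus ?thesis using assms unfolding ideal_mpoly_ring_iff by fastforce
qed

text \<open>An ideal that is maximal among the ideals disjoint from \<open>T\<close> is prime: \<open>Q + (a)\<close> and
  \<open>Q + (b)\<close> would both meet \<open>T\<close>, and the product of the two common elements lies in
  \<open>Q + (ab)\<close>.\<close>

lemma exists_primeideal_disjoint:
  fixes J :: "('k::comm_ring_1) mpoly set"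
  assumes J: "ideal J (mpoly_ring V)"
    and T: "T \<subseteq> polys V" "1 \<in> T" "\<And>a b. a \<in> T \<Longrightarrow> b \<in> T \<Longrightarrow> a * b \<in> T"
    and disj: "J \<inter> T = {}"
  obtains Q where "primeideal Q (mpoly_ring V)" "J \<subseteq> Q" "Q \<inter> T = {}"
proof -
  let ?R = "mpoly_ring V :: 'k mpoly ring"
  interpret R: cring ?R by (rule mpoly_ring_cring)
  let ?A = "{I. ideal I ?R \<and> J \<subseteq> I \<and> I \<inter> T = {}}"
  have "\<exists>M\<in>?A. \<forall>X\<in>?A. M \<subseteq> X \<longrightarrow> X = M"
  proof (rule subset_Zorn_nonempty)
    show "?A \<noteq> {}" using J disj by blast
  next
    fix C assume C: "C \<noteq> {}" "subset.chain ?A C"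
    have "subset.chain {I. ideal I ?R} C"
      using C(2) unfolding subset.chain_def by blast
    hence "ideal (\<Union>C) ?R" using R.chain_Union_is_ideal[of C] C(1) by simp
    thus "\<Union>C \<in> ?A" using C unfolding subset.chain_def by blast
  qed
  then obtain Q where QA: "Q \<in> ?A" and max': "\<forall>X\<in>?A. Q \<subseteq> X \<longrightarrow> X = Q" by (rule bexE)
  have Q: "ideal Q ?R" "J \<subseteq> Q" "Q \<inter> T = {}" using QA by auto
  have max: "X = Q" if "ideal X ?R" "X \<inter> T = {}" "Q \<subseteq> X" for X
    using max' that Q(2) by simp
  have Q': "Q \<subseteq> polys V" "0 \<in> Q" "\<And>a b. a \<in> Q \<Longrightarrow> b \<in> Q \<Longrightarrow> a + b \<in> Q"
    "\<And>a r. a \<in> Q \<Longrightarrow> r \<in> polys V \<Longrightarrow> r * a \<in> Q"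
    using Q(1) unfolding ideal_mpoly_ring_iff by auto
  have meet: "\<exists>q\<in>Q. \<exists>r\<in>polys V. q + r * a \<in> T" if a: "a \<in> polys V" "a \<notin> Q" for a :: "'k mpoly"
  proof (rule ccontr)
    assume neg: "\<not> ?thesis"
    let ?X = "{q + r * a | q r. q \<in> Q \<and> r \<in> polys V}"
    have "ideal ?X ?R"
      unfolding ideal_mpoly_ring_iff
    proof (intro conjI ballI)
      show "?X \<subseteq> polys V" using Q'(1) a by (auto intro: polys_intros)
      show "0 \<in> ?X" using Q'(2) by (auto intro!: exI[of _ 0])
    next
      fix x y :: "'k mpoly" assume "x \<in> ?X" "y \<in> ?X"
      then obtain q r q' r' where "x = q + r * a" "y = q' + r' * a" "q \<in> Q" "q' \<in> Q"
        "r \<in> polys V" "r' \<in> polys V" by blast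
      hence "x + y = (q + q') + (r + r') * a" "q + q' \<in> Q" "r + r' \<in> polys V"
        by (auto simp: algebra_simps intro: Q'(3) polys_add)
      thus "x + y \<in> ?X" by blast
    next
      fix x s :: "'k mpoly" assume "x \<in> ?X" "s \<in> polys V"
      then obtain q r where "x = q + r * a" "q \<in> Q" "r \<in> polys V" by blast
      hence "s * x = s * q + (s * r) * a" "s * q \<in> Q" "s * r \<in> polys V"
        using \<open>s \<in> polys V\<close> Q'(4)[of q s] by (auto simp: algebra_simps intro: polys_mult)
      thus "s * x \<in> ?X" by blast
    qed
    moreover have "?X \<inter> T = {}" using neg by blast
    moreover have "Q \<subseteq> ?X"
    proof
      fix q assume "q \<in> Q"
      moreover have "q = q + 0 * a" by simp
      ultimately show "q \<in> ?X" using polys_zero by blast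
    qed
    ultimately have "?X = Q" by (rule max)
    moreover have "0 + 1 * a \<in> ?X" using Q'(2) polys_one by blast
    ultimately show False using a by simp
  qed
  have "primeideal Q ?R"
    unfolding primeideal_mpoly_ring_iff
  proof (intro conjI ballI impI)
    show "ideal Q ?R" by (rule Q)
    show "1 \<notin> Q" using Q T by blast
    fix a b :: "'k mpoly" assume ab: "a \<in> polys V" "b \<in> polys V" "a * b \<in> Q"
    show "a \<in> Q \<or> b \<in> Q"
    proof (rule ccontr)
      assume "\<not> ?thesis"
      then obtain q r q' r' where *: "q \<in> Q" "r \<in> polys V" "q + r * a \<in> T"
         "q' \<in> Q" "r' \<in> polys V" "q' + r' * b \<in> T"
        using meet ab by meson
      have "(q + r * a) * (q' + r' * b) = (q' + r' * b) * q + (r * a) * q' + (r * r') * (a * b)"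
        by (simp add: algebra_simps)
      moreover have "(q' + r' * b) * q \<in> Q" "(r * a) * q' \<in> Q" "(r * r') * (a * b) \<in> Q"
        by (rule Q'(4); use * ab Q'(1) in \<open>auto intro!: polys_intros\<close>)+
      ultimately have "(q + r * a) * (q' + r' * b) \<in> Q" using Q'(3) by presburger
      thus False using T(3)[OF *(3,6)] Q(3) by blast
    qed
  qed
  thus ?thesis using Q that by blast
qed

section \<open>The regular sequence of the path\<close>

lemma inj_add_single: "inj (\<lambda>\<mu> :: nat \<Rightarrow>\<^sub>0 nat. \<mu> + Poly_Mapping.single m 1)"
  by (rule injI) simp

text \<open>Quotient and remainder on division by \<open>x\<^sub>m\<close>. That \<open>x\<^sub>m\<close> does not occur in \<open>q\<close> is
  expressed below as \<open>var_quot m q = 0\<close>.\<close>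

definition var_quot :: "nat \<Rightarrow> ('k::comm_ring_1) mpoly \<Rightarrow> 'k mpoly" where
  "var_quot m p = Poly_Mapping.map_key (\<lambda>\<mu>. \<mu> + Poly_Mapping.single m 1) p"

definition var_rem :: "nat \<Rightarrow> ('k::comm_ring_1) mpoly \<Rightarrow> 'k mpoly" where
  "var_rem m p = p - Var m * var_quot m p"

lemma lookup_var_quot: "Poly_Mapping.lookup (var_quot m p) \<mu> = Poly_Mapping.lookup p (\<mu> + Poly_Mapping.single m 1)"
  unfolding var_quot_def by (simp add: inj_add_single map_key.rep_eq del: One_nat_def)

lemma var_quot_zero [simp]: "var_quot m 0 = 0"
  and var_quot_add: "var_quot m (p + q) = var_quot m p + var_quot m q"
  and var_quot_diff: "var_quot m (p - q) = var_quot m p - var_quot m q"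
  by (rule poly_mapping_eqI, simp add: lookup_var_quot lookup_add lookup_minus)+

lemma lookup_Var_mult:
  "Poly_Mapping.lookup (Var m * p) \<mu> =
    (if Poly_Mapping.lookup \<mu> m = 0 then 0 else Poly_Mapping.lookup p (\<mu> - Poly_Mapping.single m 1))"
proof -
  have "Poly_Mapping.lookup (Var m * p) \<mu> = (\<Sum>q. Poly_Mapping.lookup p q when \<mu> = Poly_Mapping.single m 1 + q)"
  proof -
    have "Poly_Mapping.lookup (Var m * p) \<mu> =
        (\<Sum>l. (\<Sum>q. Poly_Mapping.lookup p q when \<mu> = l + q) when l = Poly_Mapping.single m 1)"
      unfolding Var_def lookup_mult
      by (rule Sum_any.cong) (auto simp: lookup_single when_def)
    thus ?thesis by (simp only: Sum_any_when_equal)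
  qed
  also have "\<dots> = (if Poly_Mapping.lookup \<mu> m = 0 then 0 else Poly_Mapping.lookup p (\<mu> - Poly_Mapping.single m 1))"
  proof (cases "Poly_Mapping.lookup \<mu> m = 0")
    case True
    hence "\<mu> \<noteq> Poly_Mapping.single m 1 + q" for q
      by (metis add_is_0 lookup_add lookup_single_eq one_neq_zero)
    thus ?thesis using True by simp
  next
    case False
    have "\<mu> = Poly_Mapping.single m 1 + (\<mu> - Poly_Mapping.single m 1)"
      by (rule poly_mapping_eqI) (use False in \<open>auto simp: lookup_add lookup_minus lookup_single when_def\<close>)
    hence "\<mu> = Poly_Mapping.single m 1 + q \<longleftrightarrow> q = \<mu> - Poly_Mapping.single m 1" for q
      by (metis add_diff_cancel_left')
    thus ?thesis using False by simp
  qed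
  finally show ?thesis .
qed

lemma var_quot_Var_mult [simp]: "var_quot m (Var m * p) = p"
  by (rule poly_mapping_eqI) (simp add: lookup_var_quot lookup_Var_mult lookup_add del: One_nat_def)

lemma var_rem_Var_mult [simp]: "var_rem m (Var m * p) = 0"
  by (simp add: var_rem_def)

lemma var_rem_quot: "p = var_rem m p + Var m * var_quot m p"
  by (simp add: var_rem_def)

lemma var_quot_rem [simp]: "var_quot m (var_rem m p) = 0"
  by (simp add: var_rem_def var_quot_diff)

lemma var_quot_eq_0_iff: "var_quot m p = 0 \<longleftrightarrow> (\<forall>\<mu> \<in> Poly_Mapping.keys p. Poly_Mapping.lookup \<mu> m = 0)"
proof
  assume L: "var_quot m p = 0"
  show "\<forall>\<mu> \<in> Poly_Mapping.keys p. Poly_Mapping.lookup \<mu> m = 0"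
  proof (intro ballI, rule ccontr)
    fix \<mu> assume \<mu>: "\<mu> \<in> Poly_Mapping.keys p" "Poly_Mapping.lookup \<mu> m \<noteq> 0"
    have "\<mu> = (\<mu> - Poly_Mapping.single m 1) + Poly_Mapping.single m 1"
      by (rule poly_mapping_eqI) (use \<mu> in \<open>auto simp: lookup_add lookup_minus lookup_single when_def\<close>)
    thus False using \<mu> L lookup_var_quot[of m p "\<mu> - Poly_Mapping.single m 1"]
      by (simp add: in_keys_iff)
  qed
next
  assume "\<forall>\<mu> \<in> Poly_Mapping.keys p. Poly_Mapping.lookup \<mu> m = 0"
  hence "Poly_Mapping.lookup p (\<mu> + Poly_Mapping.single m 1) = 0" for \<mu>
    by (metis add_is_0 in_keys_iff lookup_add lookup_single_eq one_neq_zero)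
  thus "var_quot m p = 0" by (intro poly_mapping_eqI) (simp add: lookup_var_quot)
qed

lemma var_quot_mult_eq_0:
  "var_quot m p = 0 \<Longrightarrow> var_quot m q = 0 \<Longrightarrow> var_quot m (p * q) = 0"
  using keys_mult[of p q] by (fastforce simp: var_quot_eq_0_iff lookup_add)

text \<open>Division by x_m is linear over polynomials free of x_m: multiplying p = r + x_m p' by
  such a q leaves r q free of x_m.\<close>

lemma var_quot_mult:
  assumes "var_quot m q = 0"
  shows "var_quot m (p * q) = var_quot m p * q"
proof -
  have "p * q = var_rem m p * q + Var m * (var_quot m p * q)"
    by (subst var_rem_quot[of p m]) (simp add: algebra_simps)
  thus ?thesis using var_quot_mult_eq_0[OF var_quot_rem assms]
    by (simp add: var_quot_add)
qed

lemma var_rem_add: "var_rem m (p + q) = var_rem m p + var_rem m q"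
  and var_rem_diff: "var_rem m (p - q) = var_rem m p - var_rem m q"
  by (simp_all add: var_rem_def var_quot_add var_quot_diff algebra_simps)

lemma var_rem_mult: "var_quot m q = 0 \<Longrightarrow> var_rem m (p * q) = var_rem m p * q"
  by (simp add: var_rem_def var_quot_mult algebra_simps)

lemma var_quot_Var [simp]: "i \<noteq> m \<Longrightarrow> var_quot m (Var i) = 0"
  by (simp add: var_quot_eq_0_iff Var_def lookup_single)

lemma polys_var_quot:
  assumes "p \<in> polys V"
  shows "var_quot m p \<in> polys V"
  unfolding polys_iff
proof
  fix \<mu> assume "\<mu> \<in> Poly_Mapping.keys (var_quot m p)"
  hence "\<mu> + Poly_Mapping.single m 1 \<in> Poly_Mapping.keys p"
    by (simp add: in_keys_iff lookup_var_quot)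
  hence "Poly_Mapping.keys (\<mu> + Poly_Mapping.single m 1) \<subseteq> V"
    using assms by (simp add: polys_iff)
  thus "Poly_Mapping.keys \<mu> \<subseteq> V"
    by (auto simp: in_keys_iff lookup_add subset_iff)
qed

text \<open>The variable x_m may lie outside \<open>V\<close>, so the claim is read off from the
  monomials: the remainder only selects those of p that are free of x_m.\<close>

lemma polys_var_rem:
  assumes "p \<in> polys V"
  shows "var_rem m p \<in> polys V"
proof -
  have "Poly_Mapping.keys (var_rem m p) \<subseteq> Poly_Mapping.keys p"
  proof
    fix \<mu> assume \<mu>: "\<mu> \<in> Poly_Mapping.keys (var_rem m p)"
    hence "Poly_Mapping.lookup \<mu> m = 0" using var_quot_rem[of m p] var_quot_eq_0_iff by blast
    thus "\<mu> \<in> Poly_Mapping.keys p"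
      using \<mu> by (simp add: var_rem_def in_keys_iff lookup_minus lookup_Var_mult)
  qed
  thus ?thesis using assms by (auto simp: polys_iff)
qed

section \<open>Ideals of consecutive minors and their regularity\<close>

definition consec_minor :: "nat \<Rightarrow> ('k::comm_ring_1) mpoly" where
  "consec_minor i = hankel_minor (i + 1) (i + 2)"

lemma consec_minor_eq: "consec_minor i = Var (i + 3) * Var (i + 1) - Var (i + 2) * Var (i + 2)"
  by (simp add: consec_minor_def hankel_minor_def mult.commute eval_nat_numeral)

text \<open>Ideal of the first i minors. The recursion hands every member over as a + q f_i, which
  is what the inductions on i consume. Counting minors from 0, the first i of them involve only x_1,
  ..., x_(i+2), and f_i adds x_(i+3).\<close>

fun path_ideal :: "nat set \<Rightarrow> nat \<Rightarrow> ('k::comm_ring_1) mpoly set" where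
  "path_ideal V 0 = {0}"
| "path_ideal V (Suc i) = {a + q * consec_minor i | a q. a \<in> path_ideal V i \<and> q \<in> polys V}"

lemma path_ideal_ideal:
  assumes "{1..i + 2} \<subseteq> V"
  shows "ideal (path_ideal V i :: ('k::comm_ring_1) mpoly set) (mpoly_ring V)"
  using assms
proof (induction i)
  case 0
  show ?case by (simp add: ideal_mpoly_ring_iff)
next
  case (Suc i)
  have V: "{1..i + 2} \<subseteq> V" using Suc.prems by auto
  have f: "(consec_minor i :: 'k mpoly) \<in> polys V"
    unfolding consec_minor_eq using Suc.prems by (intro polys_intros) auto
  have IH: "path_ideal V i \<subseteq> (polys V :: 'k mpoly set)" "0 \<in> (path_ideal V i :: 'k mpoly set)"
    "\<And>a b :: 'k mpoly. a \<in> path_ideal V i \<Longrightarrow> b \<in> path_ideal V i \<Longrightarrow> a + b \<in> path_ideal V i"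
    "\<And>a r :: 'k mpoly. a \<in> path_ideal V i \<Longrightarrow> r \<in> polys V \<Longrightarrow> r * a \<in> path_ideal V i"
    using Suc.IH[OF V] unfolding ideal_mpoly_ring_iff by blast+
  show ?case
    unfolding ideal_mpoly_ring_iff
  proof (intro conjI ballI)
    show "path_ideal V (Suc i) \<subseteq> (polys V :: 'k mpoly set)"
      using IH(1) f by (auto intro: polys_add polys_mult)
    show "0 \<in> (path_ideal V (Suc i) :: 'k mpoly set)"
      using IH(2) by (auto intro!: exI[of _ 0])
  next
    fix x y :: "'k mpoly" assume "x \<in> path_ideal V (Suc i)" "y \<in> path_ideal V (Suc i)"
    then obtain a q b r where "x = a + q * consec_minor i" "y = b + r * consec_minor i"
      "a \<in> path_ideal V i" "b \<in> path_ideal V i" "q \<in> polys V" "r \<in> polys V" by auto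
    hence "x + y = (a + b) + (q + r) * consec_minor i" "a + b \<in> path_ideal V i" "q + r \<in> polys V"
      using IH(3) by (simp_all add: algebra_simps polys_add)
    thus "x + y \<in> path_ideal V (Suc i)" by auto
  next
    fix x r :: "'k mpoly" assume "x \<in> path_ideal V (Suc i)" "r \<in> polys V"
    then obtain a q where "x = a + q * consec_minor i" "a \<in> path_ideal V i" "q \<in> polys V" by auto
    hence "r * x = r * a + (r * q) * consec_minor i" "r * a \<in> path_ideal V i" "r * q \<in> polys V"
      using IH(4)[of a r] \<open>r \<in> polys V\<close> by (simp_all add: algebra_simps polys_mult)
    thus "r * x \<in> path_ideal V (Suc i)" by auto
  qed
qed

lemma path_ideal_subset:
  assumes "ideal I (mpoly_ring V)" "\<And>j. j < i \<Longrightarrow> consec_minor j \<in> I"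
  shows "path_ideal V i \<subseteq> I"
  using assms(2)
proof (induction i)
  case 0
  thus ?case using assms(1) by (simp add: ideal_mpoly_ring_iff)
next
  case (Suc i)
  thus ?case using assms(1) by (auto simp: ideal_mpoly_ring_iff subset_iff)
qed

lemma consec_minor_in_path_ideal:
  assumes "{1..i + 2} \<subseteq> V" "j < i"
  shows "(consec_minor j :: ('k::comm_ring_1) mpoly) \<in> path_ideal V i"
  using assms
proof (induction i)
  case (Suc i)
  have 0: "0 \<in> (path_ideal V i :: 'k mpoly set)"
  proof -
    have "{1..i + 2} \<subseteq> V" using Suc.prems by auto
    thus ?thesis using path_ideal_ideal[of i V] unfolding ideal_mpoly_ring_iff by blast
  qed
  show ?case
  proof (cases "j = i")
    case True
    have "0 + 1 * consec_minor i \<in> (path_ideal V (Suc i) :: 'k mpoly set)"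
      using 0 polys_one unfolding path_ideal.simps by blast
    thus ?thesis using True by simp
  next
    case False
    moreover have "{1..i + 2} \<subseteq> V" using Suc.prems by auto
    ultimately have "(consec_minor j :: 'k mpoly) \<in> path_ideal V i" using Suc by simp
    hence "consec_minor j + 0 * consec_minor i \<in> (path_ideal V (Suc i) :: 'k mpoly set)"
      using polys_zero unfolding path_ideal.simps by blast
    thus ?thesis by simp
  qed
qed simp

text \<open>Since x_m occurs in none of the first i minors, division by x_m acts on the coefficients
  alone. The same holds for the remainder below.\<close>

lemma path_ideal_var_quot:
  fixes p :: "('k::comm_ring_1) mpoly"
  shows "p \<in> path_ideal V i \<Longrightarrow> i + 2 < m \<Longrightarrow> var_quot m p \<in> path_ideal V i"
proof (induction i arbitrary: p)
  case (Suc i)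
  then obtain a q where p: "p = a + q * consec_minor i" "a \<in> path_ideal V i" "q \<in> polys V" by auto
  have "var_quot m (consec_minor i :: 'k mpoly) = 0"
    unfolding consec_minor_eq var_quot_diff using Suc.prems by (simp add: var_quot_mult)
  hence "var_quot m p = var_quot m a + var_quot m q * consec_minor i"
    using p by (simp add: var_quot_add var_quot_mult)
  thus ?case using Suc.IH[OF p(2)] Suc.prems(2) polys_var_quot[OF p(3)] by auto
qed simp

lemma path_ideal_var_rem:
  fixes p :: "('k::comm_ring_1) mpoly"
  shows "p \<in> path_ideal V i \<Longrightarrow> i + 2 < m \<Longrightarrow> var_rem m p \<in> path_ideal V i"
proof (induction i arbitrary: p)
  case (Suc i)
  then obtain a q where p: "p = a + q * consec_minor i" "a \<in> path_ideal V i" "q \<in> polys V" by auto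
  have "var_quot m (consec_minor i :: 'k mpoly) = 0"
    unfolding consec_minor_eq var_quot_diff using Suc.prems by (simp add: var_quot_mult)
  hence "var_rem m p = var_rem m a + var_rem m q * consec_minor i"
    using p by (simp add: var_rem_add var_rem_mult)
  thus ?case using Suc.IH[OF p(2)] Suc.prems(2) polys_var_rem[OF p(3)] by auto
qed (simp add: var_rem_def)

text \<open>Taking the remainder means setting x_(i+3) to zero, which kills the first term of the
  minor.\<close>

lemma var_rem_mult_consec_minor:
  fixes q :: "('k::comm_ring_1) mpoly"
  shows "var_rem (i + 3) (q * consec_minor i) = - (var_rem (i + 3) q * (Var (i + 2) * Var (i + 2)))"
proof -
  have "q * consec_minor i = Var (i + 3) * (q * Var (i + 1)) - q * (Var (i + 2) * Var (i + 2))"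
    by (simp add: consec_minor_eq algebra_simps)
  moreover have "var_quot (i + 3) (Var (i + 2) * Var (i + 2) :: 'k mpoly) = 0"
    by (simp add: var_quot_mult)
  ultimately show ?thesis by (simp add: var_rem_diff var_rem_mult)
qed

lemma path_ideal_uminus:
  fixes p :: "('k::comm_ring_1) mpoly"
  assumes "{1..i + 2} \<subseteq> V" "- p \<in> path_ideal V i"
  shows "p \<in> path_ideal V i"
proof -
  have "(- 1) * (- p) \<in> path_ideal V i"
    using path_ideal_ideal[OF assms(1)] assms(2) polys_uminus[OF polys_one, of V]
    unfolding ideal_mpoly_ring_iff by blast
  thus ?thesis by simp
qed

text \<open>Modulo \<open>x\<^bsub>i+3\<^esub>\<close> the generator \<open>x\<^bsub>i+1\<^esub> x\<^bsub>i+3\<^esub> - x\<^bsub>i+2\<^esub>\<^sup>2\<close> becomes \<open>- x\<^bsub>i+2\<^esub>\<^sup>2\<close>, which is regular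
  by induction, while \<open>x\<^bsub>i+3\<^esub>\<close> does not occur in the earlier generators.\<close>

lemma Var_regular_path_ideal:
  fixes h :: "('k::comm_ring_1) mpoly"
  assumes "{1..i + 2} \<subseteq> V" "h \<in> polys V" "Var (i + 2) * h \<in> path_ideal V i"
  shows "h \<in> path_ideal V i"
  using assms
proof (induction i arbitrary: h)
  case 0
  hence "Var 2 * h = 0" by (simp add: numeral_2_eq_2)
  hence "var_quot 2 (Var 2 * h) = 0" by (simp only: var_quot_zero)
  thus ?case by simp
next
  case (Suc i)
  let ?x = "Var (i + 3) :: 'k mpoly" and ?y = "Var (i + 2) :: 'k mpoly"
  have V: "{1..i + 2} \<subseteq> V" using Suc.prems(1) by auto
  have y: "?y \<in> polys V" using V by (intro polys_Var) auto
  have x: "Var (Suc i + 2) = ?x" by (simp add: eval_nat_numeral)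
  obtain a q where aq: "?x * h = a + q * consec_minor i" "a \<in> path_ideal V i" "q \<in> polys V"
    using Suc.prems(3) unfolding x by auto
  let ?q = "var_rem (i + 3) q" and ?q' = "var_quot (i + 3) q"
  have q: "?q \<in> polys V" "?q' \<in> polys V" using aq by (simp_all add: polys_var_rem polys_var_quot)
  have "0 = var_rem (i + 3) (a + q * consec_minor i)" unfolding aq(1)[symmetric] by simp
  also have "\<dots> = var_rem (i + 3) a - ?y * (?y * ?q)"
    by (simp only: var_rem_add var_rem_mult_consec_minor) (simp add: algebra_simps)
  finally have "?y * (?y * ?q) = var_rem (i + 3) a" by simp
  hence "?y * (?y * ?q) \<in> path_ideal V i" using path_ideal_var_rem[OF aq(2), of "i + 3"] by simp
  hence qJ: "?q \<in> path_ideal V i"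
    using Suc.IH[OF V] q y by (blast intro: polys_mult)
  have J: "ideal (path_ideal V i :: 'k mpoly set) (mpoly_ring V)" by (rule path_ideal_ideal[OF V])
  have "(consec_minor i :: 'k mpoly) \<in> polys V"
    unfolding consec_minor_eq using Suc.prems by (intro polys_intros) auto
  \<comment> \<open>Writing q = \<open>?q\<close> + x_(i+3) \<open>?q'\<close>, the part with
    \<open>?q\<close> is absorbed into the ideal. What is left of \<open>?x * h\<close> is a
    multiple of x_(i+3), which path_ideal_var_quot cancels.\<close>
  hence "a + consec_minor i * ?q \<in> path_ideal V i"
    using J aq(2) qJ unfolding ideal_mpoly_ring_iff by blast
  moreover have "?x * (h - ?q' * consec_minor i) = a + consec_minor i * ?q"
    using aq(1) arg_cong[OF var_rem_quot[of q "i + 3"], of "\<lambda>t. t * consec_minor i"]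
    by (simp add: algebra_simps)
  ultimately have "var_quot (i + 3) (?x * (h - ?q' * consec_minor i)) \<in> path_ideal V i"
    by (intro path_ideal_var_quot) simp_all
  hence "h - ?q' * consec_minor i \<in> path_ideal V i" by simp
  moreover have "h = (h - ?q' * consec_minor i) + ?q' * consec_minor i" by simp
  ultimately show ?case using q(2) unfolding path_ideal.simps by blast
qed

text \<open>Induction on a strict bound for the degree of h in x_(i+3), so that the base case is h =
  0. Modulo x_(i+3) the product is -x_(i+2)^2 times the remainder of h, so that remainder lies in
  the ideal by regularity of x_(i+2). Subtracting its contribution and cancelling x_(i+3) leaves the
  quotient of h, of smaller degree.\<close>

lemma consec_minor_regular_path_ideal:
  fixes h :: "('k::comm_ring_1) mpoly"
  assumes V: "{1..i + 3} \<subseteq> V" and "h \<in> polys V" "h * consec_minor i \<in> path_ideal V i"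
  shows "h \<in> path_ideal V i"
proof -
  let ?x = "Var (i + 3) :: 'k mpoly" and ?y = "Var (i + 2) :: 'k mpoly"
  have V': "{1..i + 2} \<subseteq> V" using V by auto
  have x: "?x \<in> polys V" and y: "?y \<in> polys V" using V by (auto intro!: polys_Var)
  have J: "ideal (path_ideal V i :: 'k mpoly set) (mpoly_ring V)" by (rule path_ideal_ideal[OF V'])
  have f: "(consec_minor i :: 'k mpoly) \<in> polys V"
    unfolding consec_minor_eq using V by (intro polys_intros) auto
  have "h \<in> path_ideal V i"
    if "\<forall>\<mu> \<in> Poly_Mapping.keys h. Poly_Mapping.lookup \<mu> (i + 3) < N" "h \<in> polys V"
      "h * consec_minor i \<in> path_ideal V i" for N and h :: "'k mpoly"
    using that
  proof (induction N arbitrary: h)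
    case 0
    hence "h = 0" by simp
    thus ?case using J by (simp add: ideal_mpoly_ring_iff)
  next
    case (Suc N)
    let ?h = "var_rem (i + 3) h" and ?h' = "var_quot (i + 3) h"
    have h: "?h \<in> polys V" "?h' \<in> polys V"
      using Suc.prems by (simp_all add: polys_var_rem polys_var_quot)
    have "var_rem (i + 3) (h * consec_minor i) \<in> path_ideal V i"
      using Suc.prems(3) by (intro path_ideal_var_rem) auto
    hence "- (?y * (?y * ?h)) \<in> path_ideal V i"
      by (simp only: var_rem_mult_consec_minor) (simp add: algebra_simps)
    hence "?y * (?y * ?h) \<in> path_ideal V i" by (rule path_ideal_uminus[OF V'])
    hence hJ: "?h \<in> path_ideal V i"
      using Var_regular_path_ideal[OF V'] h y by (blast intro: polys_mult)
    have "h * consec_minor i - consec_minor i * ?h \<in> path_ideal V i"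
      using Suc.prems(3) hJ f J by (intro ideal_diffI[OF J]) (auto simp: ideal_mpoly_ring_iff)
    also have "h * consec_minor i - consec_minor i * ?h = ?x * (?h' * consec_minor i)"
      using arg_cong[OF var_rem_quot[of h "i + 3"], of "\<lambda>t. t * consec_minor i"]
      by (simp add: algebra_simps)
    finally have "var_quot (i + 3) (?x * (?h' * consec_minor i)) \<in> path_ideal V i"
      by (intro path_ideal_var_quot) auto
    hence "?h' * consec_minor i \<in> path_ideal V i" by simp
    moreover have "\<forall>\<mu> \<in> Poly_Mapping.keys ?h'. Poly_Mapping.lookup \<mu> (i + 3) < N"
    proof
      fix \<mu> assume "\<mu> \<in> Poly_Mapping.keys ?h'"
      hence "\<mu> + Poly_Mapping.single (i + 3) 1 \<in> Poly_Mapping.keys h"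
        by (simp add: in_keys_iff lookup_var_quot del: One_nat_def)
      thus "Poly_Mapping.lookup \<mu> (i + 3) < N"
        using Suc.prems(1) by (fastforce simp: lookup_add)
    qed
    ultimately have "?h' \<in> path_ideal V i" using Suc.IH h(2) by blast
    thus ?case
      using J hJ x var_rem_quot[of h "i + 3"] unfolding ideal_mpoly_ring_iff by metis
  qed
  moreover have "\<exists>N. \<forall>\<mu> \<in> Poly_Mapping.keys h. Poly_Mapping.lookup \<mu> (i + 3) < N"
    using finite_nat_set_iff_bounded[of "(\<lambda>\<mu>. Poly_Mapping.lookup \<mu> (i + 3)) ` Poly_Mapping.keys h"] by auto
  ultimately show ?thesis using assms by blast
qed

lemma primeideal_chain_path_ideal:
  fixes P :: "('k::comm_ring_1) mpoly set"
  assumes "{1..r + 2} \<subseteq> V" "primeideal P (mpoly_ring V)" "\<And>j. j < r \<Longrightarrow> consec_minor j \<in> P"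
  shows "\<exists>c. (\<forall>i\<le>r. primeideal (c i) (mpoly_ring V)) \<and> (\<forall>i<r. c i \<subset> c (Suc i)) \<and> c r = P"
  using assms
proof (induction r arbitrary: P)
  case 0
  thus ?case by (intro exI[of _ "\<lambda>_. P"]) simp
next
  case (Suc r)
  let ?R = "mpoly_ring V :: 'k mpoly ring" and ?f = "consec_minor r :: 'k mpoly"
  have V: "{1..r + 2} \<subseteq> V" "{1..r + 3} \<subseteq> V" using Suc.prems(1) by auto
  have P: "ideal P ?R" "1 \<notin> P" "\<And>a b. a \<in> polys V \<Longrightarrow> b \<in> polys V \<Longrightarrow> a * b \<in> P \<Longrightarrow> a \<in> P \<or> b \<in> P"
    using Suc.prems(2) unfolding primeideal_mpoly_ring_iff by blast+
  have f: "?f \<in> polys V"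
    unfolding consec_minor_eq using V by (intro polys_intros) auto
  have J: "ideal (path_ideal V r) ?R" by (rule path_ideal_ideal[OF V(1)])
  have JP: "path_ideal V r \<subseteq> P" using Suc.prems(3) by (intro path_ideal_subset P) simp
  \<comment> \<open>Taking e = 0 puts the complement of \<open>P\<close> into \<open>?T\<close>, so
    a prime avoiding \<open>?T\<close> lies inside \<open>P\<close>; taking s = 1 and e = 1 shows
    that it omits \<open>?f\<close>, so the inclusion is strict.\<close>
  let ?T = "{s * ?f ^ e | s e. s \<in> polys V - P}"
  \<comment> \<open>Regularity strips off the factors \<open>?f\<close> one at a time, until s
    itself would lie in \<open>path_ideal V r\<close> and hence in \<open>P\<close>.\<close>
  have disj: "s * ?f ^ e \<notin> path_ideal V r" if "s \<in> polys V - P" for s e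
  proof (induction e)
    case 0
    thus ?case using that JP by auto
  next
    case (Suc e)
    show ?case
    proof
      assume "s * ?f ^ Suc e \<in> path_ideal V r"
      hence "(s * ?f ^ e) * ?f \<in> path_ideal V r" by (simp only: power_Suc2 mult.assoc)
      hence "s * ?f ^ e \<in> path_ideal V r"
        using that f by - (rule consec_minor_regular_path_ideal[OF V(2)], auto intro: polys_mult polys_power)
      thus False using Suc by simp
    qed
  qed
  obtain Q where Q: "primeideal Q ?R" "path_ideal V r \<subseteq> Q" "Q \<inter> ?T = {}"
  proof (rule exists_primeideal_disjoint[OF J])
    show "?T \<subseteq> polys V" using f by (auto intro!: polys_intros)
    have "1 * ?f ^ 0 \<in> ?T" using P(2) polys_one by blast
    thus "1 \<in> ?T" by simp
    show "path_ideal V r \<inter> ?T = {}" using disj by blast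
    fix a b assume "a \<in> ?T" "b \<in> ?T"
    then obtain s e s' e' where "a = s * ?f ^ e" "b = s' * ?f ^ e'"
      "s \<in> polys V - P" "s' \<in> polys V - P" by blast
    hence "a * b = (s * s') * ?f ^ (e + e')" "s * s' \<in> polys V - P"
      using P(3) by (auto simp: power_add mult_ac intro: polys_mult)
    thus "a * b \<in> ?T" by blast
  qed
  have QV: "Q \<subseteq> polys V" using Q(1) unfolding primeideal_mpoly_ring_iff ideal_mpoly_ring_iff by blast
  have "Q \<subseteq> P"
  proof
    fix s assume s: "s \<in> Q"
    show "s \<in> P"
    proof (rule ccontr)
      assume "s \<notin> P"
      hence "s * ?f ^ 0 \<in> ?T" using s QV by blast
      thus False using s Q(3) by auto
    qed
  qed
  moreover have "?f \<notin> Q"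
  proof
    assume "?f \<in> Q"
    moreover have "1 * ?f ^ 1 \<in> ?T" using P(2) polys_one by blast
    ultimately show False using Q(3) by auto
  qed
  ultimately have "Q \<subset> P" using Suc.prems(3)[of r] by auto
  have "consec_minor j \<in> Q" if "j < r" for j
    using consec_minor_in_path_ideal[OF V(1) that] Q(2) by blast
  then obtain c where c: "\<forall>i\<le>r. primeideal (c i) ?R" "\<forall>i<r. c i \<subset> c (Suc i)" "c r = Q"
    using Suc.IH[OF V(1) Q(1)] by blast
  show ?case
    by (rule exI[of _ "c(Suc r := P)"])
      (use c Suc.prems(2) \<open>Q \<subset> P\<close> in \<open>auto simp: le_Suc_eq less_Suc_eq\<close>)
qed

section \<open>Growth of residue class rings\<close>

definition cmult :: "'k::field \<Rightarrow> 'k mpoly \<Rightarrow> 'k mpoly" where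
  "cmult c p = Poly_Mapping.single 0 c * p"

text \<open>Provides span, dependence and the exchange bound
  \<open>mpoly.independent_span_bound\<close>, on which both the count of generators and the growth
  bound rest.\<close>

interpretation mpoly: vector_space cmult
  by unfold_locales
    (simp_all add: cmult_def algebra_simps single_add mult_single flip: mult.assoc)

lemma cmult_single [simp]: "cmult c (Poly_Mapping.single \<mu> a) = Poly_Mapping.single \<mu> (c * a)"
  by (simp add: cmult_def mult_single)

lemma mult_cmult: "p * cmult c q = cmult c (p * q)"
  by (simp add: cmult_def mult.left_commute)

lemma polys_cmult: "p \<in> polys V \<Longrightarrow> cmult c p \<in> polys V"
  unfolding cmult_def by (intro polys_mult polys_single) simp_all

lemma ideal_cmult: "ideal I (mpoly_ring V) \<Longrightarrow> p \<in> I \<Longrightarrow> cmult c p \<in> I"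
  using polys_single[of 0 V c] unfolding ideal_mpoly_ring_iff cmult_def by simp

lemma sum_monomials:
  fixes p :: "('k::comm_ring_1) mpoly"
  assumes "finite S" "Poly_Mapping.keys p \<subseteq> S"
  shows "(\<Sum>\<mu>\<in>S. Poly_Mapping.single \<mu> (Poly_Mapping.lookup p \<mu>)) = p"
proof (rule poly_mapping_eqI)
  fix \<nu>
  have "Poly_Mapping.lookup (\<Sum>\<mu>\<in>S. Poly_Mapping.single \<mu> (Poly_Mapping.lookup p \<mu>)) \<nu> =
      (\<Sum>\<mu>\<in>S. if \<mu> = \<nu> then Poly_Mapping.lookup p \<mu> else 0)"
    by (simp add: lookup_sum lookup_single when_def)
  also have "\<dots> = Poly_Mapping.lookup p \<nu>"
    using assms by (auto simp: sum.delta' in_keys_iff)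
  finally show "Poly_Mapping.lookup (\<Sum>\<mu>\<in>S. Poly_Mapping.single \<mu> (Poly_Mapping.lookup p \<mu>)) \<nu> =
    Poly_Mapping.lookup p \<nu>" .
qed

lemma sum_weighted_superset:
  assumes "finite S" "Poly_Mapping.keys \<mu> \<subseteq> S"
  shows "(\<Sum>i\<in>Poly_Mapping.keys \<mu>. g i * Poly_Mapping.lookup \<mu> i) =
    (\<Sum>i\<in>S. g i * Poly_Mapping.lookup \<mu> i :: nat)"
  using assms by (intro sum.mono_neutral_left) (auto simp: in_keys_iff)

text \<open>The weight g is general to serve twice: g = 1 gives the total degree, and g i = i gives
  the second exponent in the parametrization of the curve.\<close>

lemma sum_weighted_add:
  "(\<Sum>i\<in>Poly_Mapping.keys (\<mu> + \<nu>). g i * Poly_Mapping.lookup (\<mu> + \<nu>) i) =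
    (\<Sum>i\<in>Poly_Mapping.keys \<mu>. g i * Poly_Mapping.lookup \<mu> i) +
    (\<Sum>i\<in>Poly_Mapping.keys \<nu>. g i * Poly_Mapping.lookup \<nu> i :: nat)"
proof -
  let ?S = "Poly_Mapping.keys \<mu> \<union> Poly_Mapping.keys \<nu>"
  have "(\<Sum>i\<in>Poly_Mapping.keys (\<mu> + \<nu>). g i * Poly_Mapping.lookup (\<mu> + \<nu>) i) =
      (\<Sum>i\<in>?S. g i * Poly_Mapping.lookup (\<mu> + \<nu>) i)"
    using Poly_Mapping.keys_add[of \<mu> \<nu>] by (intro sum_weighted_superset) auto
  thus ?thesis
    using sum_weighted_superset[of ?S \<mu> g] sum_weighted_superset[of ?S \<nu> g]
    by (simp add: lookup_add distrib_left sum.distrib)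
qed

lemma monom_degree_add: "monom_degree (\<mu> + \<nu>) = monom_degree \<mu> + monom_degree \<nu>"
  using sum_weighted_add[of "\<lambda>_. 1" \<mu> \<nu>] by (simp add: monom_degree_def)

lemma monom_degree_single [simp]: "monom_degree (Poly_Mapping.single i a) = a"
  by (simp add: monom_degree_def)

lemma monom_degree_zero [simp]: "monom_degree 0 = 0"
  by (simp add: monom_degree_def)

lemma lookup_le_monom_degree: "Poly_Mapping.lookup \<mu> i \<le> monom_degree \<mu>"
proof (cases "i \<in> Poly_Mapping.keys \<mu>")
  case True
  thus ?thesis unfolding monom_degree_def by (intro member_le_sum) auto
qed (simp add: in_keys_iff)

lemma monom_degree_eq_0_iff: "monom_degree \<mu> = 0 \<longleftrightarrow> \<mu> = 0"
proof
  assume "monom_degree \<mu> = 0"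
  hence "Poly_Mapping.lookup \<mu> i = 0" for i using lookup_le_monom_degree[of \<mu> i] by simp
  thus "\<mu> = 0" by (intro poly_mapping_eqI) simp
qed simp

section \<open>Degree bounds and independence modulo an ideal\<close>

definition deg_le :: "nat \<Rightarrow> ('k::comm_ring_1) mpoly \<Rightarrow> bool" where
  "deg_le d p \<longleftrightarrow> (\<forall>\<mu> \<in> Poly_Mapping.keys p. monom_degree \<mu> \<le> d)"

lemma deg_le_mult:
  fixes p q :: "('k::comm_ring_1) mpoly"
  assumes "deg_le d p" "deg_le e q"
  shows "deg_le (d + e) (p * q)"
  using assms keys_mult[of p q] unfolding deg_le_def
  by (fastforce simp: monom_degree_add intro: add_mono)

lemma deg_le_mono: "deg_le d p \<Longrightarrow> d \<le> e \<Longrightarrow> deg_le e p"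
  unfolding deg_le_def by (auto intro: le_trans)

lemma ex_deg_le: "\<exists>d. deg_le d p"
proof -
  have "\<forall>\<mu> \<in> Poly_Mapping.keys p. monom_degree \<mu> \<le> Max (monom_degree ` Poly_Mapping.keys p)"
    by simp
  thus ?thesis unfolding deg_le_def by blast
qed

text \<open>Linear independence of residue classes, stated on representatives. Distinct members have
  distinct classes, so \<open>card B\<close> bounds a dimension of the residue class ring from
  below.\<close>

definition indep_mod :: "('k::field) mpoly set \<Rightarrow> 'k mpoly set \<Rightarrow> bool" where
  "indep_mod P B \<longleftrightarrow> finite B \<and>
    (\<forall>c. (\<Sum>b\<in>B. cmult (c b) b) \<in> P \<longrightarrow> (\<forall>b\<in>B. c b = 0))"

lemma indep_modD: "indep_mod P B \<Longrightarrow> (\<Sum>b\<in>B. cmult (c b) b) \<in> P \<Longrightarrow> b \<in> B \<Longrightarrow> c b = 0"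
  unfolding indep_mod_def by blast

lemma indep_mod_mono: "indep_mod Q B \<Longrightarrow> P \<subseteq> Q \<Longrightarrow> indep_mod P B"
  unfolding indep_mod_def by blast

lemma indep_mod_notin:
  assumes "indep_mod Q B" "b \<in> B"
  shows "b \<notin> Q"
proof
  assume "b \<in> Q"
  have fin: "finite B" using assms by (simp add: indep_mod_def)
  have "(\<Sum>x\<in>B. cmult (if x = b then 1 else 0) x) = (\<Sum>x\<in>B. if x = b then x else 0)"
    by (intro sum.cong) auto
  also have "\<dots> = b" using fin assms by simp
  finally have "(\<Sum>x\<in>B. cmult (if x = b then 1 else 0) x) \<in> Q" using \<open>b \<in> Q\<close> by simp
  from indep_modD[OF assms(1) this assms(2)] show False by simp
qed

text \<open>Read a relation modulo Q first: the multiples of f vanish there, so the coefficients on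
  B are zero. What remains is f times a combination of B' lying in P, and primality cancels
  f.\<close>

lemma indep_mod_Un:
  fixes P Q :: "('k::field) mpoly set"
  assumes P: "primeideal P (mpoly_ring V)" and Q: "primeideal Q (mpoly_ring V)" and "P \<subseteq> Q"
    and f: "f \<in> Q" "f \<notin> P"
    and B: "indep_mod Q B" "B \<subseteq> polys V" and B': "indep_mod P B'" "B' \<subseteq> polys V"
  shows "indep_mod P (B \<union> (*) f ` B')" "card (B \<union> (*) f ` B') = card B + card B'"
proof -
  have idP: "ideal P (mpoly_ring V)" and idQ: "ideal Q (mpoly_ring V)"
    using P Q by (simp_all add: primeideal_mpoly_ring_iff)
  have fV: "f \<in> polys V" using f idQ by (auto simp: ideal_mpoly_ring_iff)
  have "f \<noteq> 0" using f idP by (auto simp: ideal_mpoly_ring_iff)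
  hence inj: "inj_on ((*) f) B'" by (auto intro!: inj_onI)
  have fin: "finite B" "finite B'" using B B' by (simp_all add: indep_mod_def)
  have mem: "b * f \<in> Q" if "b \<in> polys V" for b
    using that f idQ unfolding ideal_mpoly_ring_iff by blast
  \<comment> \<open>Members of an independent family are outside \<open>Q\<close>, while multiples
    of f are inside.\<close>
  have disj: "B \<inter> (*) f ` B' = {}"
    using indep_mod_notin[OF B(1)] mem B'(2) by (fastforce simp: mult.commute)
  show "card (B \<union> (*) f ` B') = card B + card B'"
    using fin disj inj by (simp add: card_Un_disjoint card_image)
  show "indep_mod P (B \<union> (*) f ` B')"
    unfolding indep_mod_def
  proof (intro conjI allI impI)
    show "finite (B \<union> (*) f ` B')" using fin by simp
    fix c assume c: "(\<Sum>b\<in>B \<union> (*) f ` B'. cmult (c b) b) \<in> P"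
    let ?s = "\<Sum>b\<in>B. cmult (c b) b" and ?t = "\<Sum>b\<in>B'. cmult (c (f * b)) b"
    have t: "?t \<in> polys V" using B' by (intro polys_sum polys_cmult) auto
    have "(\<Sum>b\<in>B \<union> (*) f ` B'. cmult (c b) b) = ?s + (\<Sum>b\<in>B'. cmult (c (f * b)) (f * b))"
      using fin disj inj by (simp add: sum.union_disjoint sum.reindex)
    also have "(\<Sum>b\<in>B'. cmult (c (f * b)) (f * b)) = ?t * f"
      unfolding mult.commute[of ?t f] sum_distrib_left mult_cmult ..
    finally have st: "?s + ?t * f \<in> P" using c by simp
    hence "(?s + ?t * f) - ?t * f \<in> Q"
      using \<open>P \<subseteq> Q\<close> mem[OF t] by (intro ideal_diffI[OF idQ]) auto
    hence s: "?s \<in> Q" by simp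
    have cB: "\<forall>b\<in>B. c b = 0" using indep_modD[OF B(1) s] by blast
    hence "?s = 0" by simp
    hence "?t * f \<in> P" using st by simp
    hence "?t \<in> P" using P t fV f unfolding primeideal_mpoly_ring_iff by blast
    hence "\<forall>b\<in>B'. c (f * b) = 0" using indep_modD[OF B'(1), of "\<lambda>b. c (f * b)"] by blast
    thus "\<forall>b\<in>B \<union> (*) f ` B'. c b = 0" using cB by auto
  qed
qed

text \<open>\<open>growth V P e\<close> says that the Hilbert function of \<open>k[V]/P\<close> grows at least like a
  polynomial of degree \<open>e\<close>.\<close>

definition growth :: "nat set \<Rightarrow> ('k::field) mpoly set \<Rightarrow> nat \<Rightarrow> bool" where
  "growth V P e \<longleftrightarrow> (\<exists>D. \<forall>m. \<exists>B. B \<subseteq> polys V \<and> (\<forall>b\<in>B. deg_le (D * m) b) \<and>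
     indep_mod P B \<and> card B = (m + e) choose e)"

text \<open>Induction on m. The family for m + 1 joins the one of Q for m + 1 to f times the one
  already built for m, and Pascal's rule adds the two binomials. Each step multiplies by f once
  more, so its degree d is added to the slope D; this is why \<open>growth\<close> allows a slope at
  all.\<close>

lemma growth_Suc:
  fixes P Q :: "('k::field) mpoly set"
  assumes P: "primeideal P (mpoly_ring V)" and Q: "primeideal Q (mpoly_ring V)" and "P \<subset> Q"
    and "growth V Q e"
  shows "growth V P (Suc e)"
proof -
  obtain f where f: "f \<in> Q" "f \<notin> P" using \<open>P \<subset> Q\<close> by blast
  obtain d where d: "deg_le d f" using ex_deg_le by blast
  have fV: "f \<in> polys V"
    using f Q unfolding primeideal_mpoly_ring_iff ideal_mpoly_ring_iff by blast
  obtain D where D: "\<And>m. \<exists>B. B \<subseteq> polys V \<and> (\<forall>b\<in>B. deg_le (D * m) b) \<and>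
     indep_mod Q B \<and> card B = (m + e) choose e"
    using assms(4) unfolding growth_def by blast
  have "\<exists>B. B \<subseteq> polys V \<and> (\<forall>b\<in>B. deg_le ((D + d) * m) b) \<and>
     indep_mod P B \<and> card B = (m + Suc e) choose Suc e" for m
  proof (induction m)
    case 0
    obtain B where "B \<subseteq> polys V" "\<forall>b\<in>B. deg_le (D * 0) b" "indep_mod Q B" "card B = (0 + e) choose e"
      using D[of 0] by blast
    thus ?case using \<open>P \<subset> Q\<close> by (intro exI[of _ B]) (auto intro: indep_mod_mono)
  next
    case (Suc m)
    obtain B where B: "B \<subseteq> polys V" "\<forall>b\<in>B. deg_le (D * Suc m) b" "indep_mod Q B"
      "card B = (Suc m + e) choose e"
      using D[of "Suc m"] by blast
    obtain B' where B': "B' \<subseteq> polys V" "\<forall>b\<in>B'. deg_le ((D + d) * m) b" "indep_mod P B'"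
      "card B' = (m + Suc e) choose Suc e"
      using Suc.IH by blast
    let ?C = "B \<union> (*) f ` B'"
    have "?C \<subseteq> polys V" using B(1) B'(1) fV by (auto intro: polys_mult)
    moreover have "deg_le ((D + d) * Suc m) b" if "b \<in> ?C" for b
      using that
    proof
      assume "b \<in> B"
      thus ?thesis using B(2) by (auto intro: deg_le_mono simp: algebra_simps)
    next
      assume "b \<in> (*) f ` B'"
      then obtain b' where b': "b = f * b'" "deg_le ((D + d) * m) b'" using B'(2) by blast
      have "deg_le (d + (D + d) * m) b" unfolding b'(1) by (rule deg_le_mult[OF d b'(2)])
      thus ?thesis by (rule deg_le_mono) (simp add: algebra_simps)
    qed
    moreover have "indep_mod P ?C" "card ?C = card B + card B'"
      using indep_mod_Un[OF P Q _ f B(3,1) B'(3,1)] \<open>P \<subset> Q\<close> by auto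
    ultimately show ?case
      using B(4) B'(4) by (intro exI[of _ ?C]) simp
  qed
  thus ?thesis unfolding growth_def by blast
qed

text \<open>Every exponent is at most d, so the monomials embed into a box. This crude count has the
  right order in d, which is all that matters.\<close>

lemma card_monomials_le:
  fixes d :: nat
  assumes V: "finite V"
  defines "M \<equiv> {\<mu> :: nat \<Rightarrow>\<^sub>0 nat. Poly_Mapping.keys \<mu> \<subseteq> V \<and> monom_degree \<mu> \<le> d}"
  shows "finite M" "card M \<le> (d + 1) ^ card V"
proof -
  let ?F = "V \<rightarrow>\<^sub>E {..d}"
  let ?r = "\<lambda>\<mu> :: nat \<Rightarrow>\<^sub>0 nat. restrict (Poly_Mapping.lookup \<mu>) V"
  have sub: "?r ` M \<subseteq> ?F"
    by (auto simp: M_def intro: order_trans[OF lookup_le_monom_degree])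
  have inj: "inj_on ?r M"
  proof (rule inj_onI, rule poly_mapping_eqI)
    fix \<mu> \<nu> i assume "\<mu> \<in> M" "\<nu> \<in> M" "?r \<mu> = ?r \<nu>"
    hence "?r \<mu> i = ?r \<nu> i" "i \<in> V \<or> i \<notin> Poly_Mapping.keys \<mu> \<and> i \<notin> Poly_Mapping.keys \<nu>"
      by (auto simp: M_def)
    thus "Poly_Mapping.lookup \<mu> i = Poly_Mapping.lookup \<nu> i"
      by (cases "i \<in> V") (simp_all add: in_keys_iff)
  qed
  have fin: "finite ?F" using V by (simp add: finite_PiE)
  show "finite M" using inj_on_finite[OF inj sub fin] .
  show "card M \<le> (d + 1) ^ card V"
    using card_inj_on_le[OF inj sub fin] V by (simp add: card_PiE)
qed

lemma card_indep_mod_le: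
  fixes B :: "('k::field) mpoly set"
  assumes "finite V" "indep_mod P B" "0 \<in> P" "B \<subseteq> polys V" "\<And>b. b \<in> B \<Longrightarrow> deg_le d b"
  shows "card B \<le> (d + 1) ^ card V"
proof -
  let ?M = "{\<mu> :: nat \<Rightarrow>\<^sub>0 nat. Poly_Mapping.keys \<mu> \<subseteq> V \<and> monom_degree \<mu> \<le> d}"
  let ?T = "(\<lambda>\<mu>. Poly_Mapping.single \<mu> (1 :: 'k)) ` ?M"
  have finB: "finite B" using assms by (simp add: indep_mod_def)
  have "\<not> mpoly.dependent B"
  proof
    assume "mpoly.dependent B"
    then obtain u v where "v \<in> B" "u v \<noteq> 0" "(\<Sum>b\<in>B. cmult (u b) b) = 0"
      using mpoly.dependent_finite[OF finB] by blast
    thus False using indep_modD[OF assms(2), of u v] assms(3) by simp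
  qed
  moreover have "B \<subseteq> mpoly.span ?T"
  proof
    fix b assume b: "b \<in> B"
    have "Poly_Mapping.keys b \<subseteq> ?M"
      using subsetD[OF assms(4) b] assms(5)[OF b] unfolding deg_le_def polys_iff by blast
    hence "(\<Sum>\<mu>\<in>Poly_Mapping.keys b. cmult (Poly_Mapping.lookup b \<mu>) (Poly_Mapping.single \<mu> 1)) \<in> mpoly.span ?T"
      by (intro mpoly.span_sum mpoly.span_scale mpoly.span_base) auto
    thus "b \<in> mpoly.span ?T" using sum_monomials[of "Poly_Mapping.keys b" b] by simp
  qed
  ultimately have "card B \<le> card ?T"
    using mpoly.independent_span_bound[of ?T B] card_monomials_le(1)[OF assms(1)] by blast
  also have "\<dots> \<le> card ?M" by (intro card_image_le card_monomials_le assms)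
  also have "\<dots> \<le> (d + 1) ^ card V" by (intro card_monomials_le assms)
  finally show ?thesis .
qed

text \<open>The right-hand side is the product (m+1)(m+2)...(m+e), with every factor at least
  m+1.\<close>

lemma power_le_fact_mult_binomial: "(m + 1) ^ e \<le> fact e * ((m + e) choose e)"
proof (induction e)
  case (Suc e)
  have "(m + 1) ^ Suc e \<le> (Suc (m + e)) * (fact e * ((m + e) choose e))"
    using Suc by (simp only: power_Suc, intro mult_mono) auto
  also have "\<dots> = fact e * (Suc e * (Suc (m + e) choose Suc e))"
    by (simp only: Suc_times_binomial) (simp only: mult_ac)
  also have "\<dots> = fact (Suc e) * ((m + Suc e) choose Suc e)"
    by (simp add: algebra_simps)
  finally show ?case .
qed simp

lemma growth_le_card:
  fixes P :: "('k::field) mpoly set"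
  assumes V: "finite V" and "0 \<in> P" and "growth V P e"
  shows "e \<le> card V"
proof (rule ccontr)
  assume "\<not> e \<le> card V"
  let ?N = "card V"
  obtain D where D: "\<And>m. \<exists>B. B \<subseteq> polys V \<and> (\<forall>b\<in>B. deg_le (D * m) b) \<and>
     indep_mod P B \<and> card B = (m + e) choose e"
    using assms(3) unfolding growth_def by blast
  \<comment> \<open>Chosen so that fact e (D m + 1)^N \<le> fact e (D + 1)^N (m + 1)^N = m (m +
    1)^N, which is below (m + 1)^(N+1).\<close>
  define m where "m = fact e * (D + 1) ^ ?N"
  obtain B where B: "B \<subseteq> polys V" "\<And>b. b \<in> B \<Longrightarrow> deg_le (D * m) b"
     "indep_mod P B" "card B = (m + e) choose e" using D[of m] by blast
  have "(m + 1) ^ Suc ?N \<le> (m + 1) ^ e" using \<open>\<not> e \<le> card V\<close> by (intro power_increasing) auto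
  also have "\<dots> \<le> fact e * ((m + e) choose e)" by (rule power_le_fact_mult_binomial)
  also have "\<dots> \<le> fact e * (D * m + 1) ^ ?N"
    using card_indep_mod_le[OF V B(3) assms(2) B(1,2)] B(4) by simp
  also have "\<dots> \<le> fact e * ((D + 1) * (m + 1)) ^ ?N"
    by (intro mult_left_mono power_mono) (simp_all add: algebra_simps)
  also have "\<dots> = m * (m + 1) ^ ?N"
    unfolding power_mult_distrib mult.assoc[symmetric] m_def[symmetric] ..
  finally show False by simp
qed

lemma primeideal_chain_length:
  fixes c :: "nat \<Rightarrow> ('k::field) mpoly set"
  assumes V: "finite V" and c: "\<And>i. i \<le> k \<Longrightarrow> primeideal (c i) (mpoly_ring V)"
    "\<And>i. i < k \<Longrightarrow> c i \<subset> c (Suc i)" and "growth V (c k) e"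
  shows "k + e \<le> card V"
proof -
  have "growth V (c (k - j)) (j + e)" if "j \<le> k" for j
    using that
  proof (induction j)
    case 0
    thus ?case using assms(4) by simp
  next
    case (Suc j)
    have "Suc (k - Suc j) = k - j" using Suc.prems by simp
    thus ?case
      using growth_Suc[of "c (k - Suc j)" V "c (k - j)" "j + e"] c(1)[of "k - Suc j"]
        c(1)[of "k - j"] c(2)[of "k - Suc j"] Suc by simp
  qed
  from this[of k] have "growth V (c 0) (k + e)" by simp
  moreover have "0 \<in> c 0"
    using c(1)[of 0] unfolding primeideal_mpoly_ring_iff ideal_mpoly_ring_iff by blast
  ultimately show ?thesis by (rule growth_le_card[OF V, rotated])
qed

section \<open>The cone over the rational normal curve\<close>

definition monom_subst :: "((nat \<Rightarrow>\<^sub>0 nat) \<Rightarrow> (nat \<Rightarrow>\<^sub>0 nat)) \<Rightarrow> ('k::comm_ring_1) mpoly \<Rightarrow> 'k mpoly" where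
  "monom_subst w p = (\<Sum>\<mu>\<in>Poly_Mapping.keys p. Poly_Mapping.single (w \<mu>) (Poly_Mapping.lookup p \<mu>))"

lemma monom_subst_superset:
  assumes "finite S" "Poly_Mapping.keys p \<subseteq> S"
  shows "monom_subst w p = (\<Sum>\<mu>\<in>S. Poly_Mapping.single (w \<mu>) (Poly_Mapping.lookup p \<mu>))"
  unfolding monom_subst_def using assms by (intro sum.mono_neutral_left) (auto simp: in_keys_iff)

lemma monom_subst_add: "monom_subst w (p + q) = monom_subst w p + monom_subst w q"
proof -
  let ?S = "Poly_Mapping.keys p \<union> Poly_Mapping.keys q"
  have "monom_subst w (p + q) = (\<Sum>\<mu>\<in>?S. Poly_Mapping.single (w \<mu>) (Poly_Mapping.lookup (p + q) \<mu>))"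
    using Poly_Mapping.keys_add[of p q] by (intro monom_subst_superset) auto
  thus ?thesis
    using monom_subst_superset[of ?S p w] monom_subst_superset[of ?S q w]
    by (simp add: lookup_add single_add sum.distrib)
qed

lemma monom_subst_zero [simp]: "monom_subst w 0 = 0"
  by (simp add: monom_subst_def)

lemma monom_subst_sum: "monom_subst w (sum f A) = (\<Sum>i\<in>A. monom_subst w (f i))"
  by (induction A rule: infinite_finite_induct) (simp_all add: monom_subst_add)

lemma monom_subst_single [simp]:
  "monom_subst w (Poly_Mapping.single \<mu> c) = Poly_Mapping.single (w \<mu>) c"
  by (simp add: monom_subst_def)

lemma monom_subst_mult:
  assumes w: "\<And>\<mu> \<nu>. w (\<mu> + \<nu>) = w \<mu> + w \<nu>"
  shows "monom_subst w (p * q) = monom_subst w p * monom_subst w q"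
proof -
  have "p * q = (\<Sum>\<mu>\<in>Poly_Mapping.keys p. \<Sum>\<nu>\<in>Poly_Mapping.keys q.
      Poly_Mapping.single (\<mu> + \<nu>) (Poly_Mapping.lookup p \<mu> * Poly_Mapping.lookup q \<nu>))"
    using sum_monomials[of "Poly_Mapping.keys p" p] sum_monomials[of "Poly_Mapping.keys q" q]
      sum_product[of "\<lambda>\<mu>. Poly_Mapping.single \<mu> (Poly_Mapping.lookup p \<mu>)" "Poly_Mapping.keys p"
        "\<lambda>\<mu>. Poly_Mapping.single \<mu> (Poly_Mapping.lookup q \<mu>)" "Poly_Mapping.keys q"]
    by (simp add: mult_single)
  hence "monom_subst w (p * q) = (\<Sum>\<mu>\<in>Poly_Mapping.keys p. \<Sum>\<nu>\<in>Poly_Mapping.keys q.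
      Poly_Mapping.single (w \<mu>) (Poly_Mapping.lookup p \<mu>) *
      Poly_Mapping.single (w \<nu>) (Poly_Mapping.lookup q \<nu>))"
    by (simp add: monom_subst_sum w mult_single)
  thus ?thesis by (simp add: monom_subst_def sum_product)
qed

text \<open>The exponent of the image of a monomial under \<open>x\<^sub>i \<mapsto> x\<^sub>0 x\<^sub>1\<^sup>i\<close>, which parametrizes the cone
  over the rational normal curve.\<close>

definition curve_exp :: "(nat \<Rightarrow>\<^sub>0 nat) \<Rightarrow> (nat \<Rightarrow>\<^sub>0 nat)" where
  "curve_exp \<mu> = Poly_Mapping.single 0 (monom_degree \<mu>) +
     Poly_Mapping.single 1 (\<Sum>i\<in>Poly_Mapping.keys \<mu>. i * Poly_Mapping.lookup \<mu> i)"

lemma curve_exp_add: "curve_exp (\<mu> + \<nu>) = curve_exp \<mu> + curve_exp \<nu>"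
  by (simp add: curve_exp_def monom_degree_add sum_weighted_add single_add algebra_simps)

lemma curve_exp_single:
  "curve_exp (Poly_Mapping.single i a) = Poly_Mapping.single 0 a + Poly_Mapping.single 1 (i * a)"
  by (simp add: curve_exp_def)

definition curve_ideal :: "nat set \<Rightarrow> ('k::field) mpoly set" where
  "curve_ideal V = {p \<in> polys V. monom_subst curve_exp p = 0}"

text \<open>It is the kernel of a ring homomorphism into polynomials over a field, which form a
  domain.\<close>

lemma primeideal_curve_ideal: "primeideal (curve_ideal V) (mpoly_ring V :: ('k::field) mpoly ring)"
proof -
  note hom = monom_subst_mult[of curve_exp, OF curve_exp_add]
  have "monom_subst curve_exp (1 :: 'k mpoly) = 1"
    using monom_subst_single[of curve_exp 0 "1 :: 'k"] by (simp add: curve_exp_def)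
  thus ?thesis
    by (auto simp: primeideal_mpoly_ring_iff ideal_mpoly_ring_iff curve_ideal_def hom
        monom_subst_add intro: polys_add polys_mult)
qed

text \<open>Both terms have degree 2 and index sum i + j + 1, hence the same image.\<close>

lemma hankel_minor_in_curve_ideal:
  assumes "{i, i + 1, j, j + 1} \<subseteq> V"
  shows "hankel_minor i j \<in> (curve_ideal V :: ('k::field) mpoly set)"
proof -
  note hom = monom_subst_mult[of curve_exp, OF curve_exp_add]
  have "monom_subst curve_exp (Var i * Var (j + 1) :: 'k mpoly) =
      monom_subst curve_exp (Var j * Var (i + 1))"
    by (simp add: hom) (simp add: Var_def mult_single curve_exp_single algebra_simps flip: single_add)
  moreover have "hankel_minor i j + Var j * Var (i + 1) = (Var i * Var (j + 1) :: 'k mpoly)"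
    by (simp add: hankel_minor_def)
  ultimately have "monom_subst curve_exp (hankel_minor i j :: 'k mpoly) = 0"
    by (metis add_cancel_left_left monom_subst_add)
  moreover have "(hankel_minor i j :: 'k mpoly) \<in> polys V"
    unfolding hankel_minor_def using assms by (intro polys_intros) auto
  ultimately show ?thesis by (simp add: curve_ideal_def)
qed

lemma card_pairs_sum_le:
  "finite {(a, b). a + b \<le> m} \<and> card {(a, b :: nat). a + b \<le> m} = (m + 2) choose 2"
proof (induction m)
  case 0
  have "{(a, b :: nat). a + b \<le> 0} = {(0, 0)}" by auto
  thus ?case by (simp add: numeral_2_eq_2)
next
  case (Suc m)
  let ?D = "(\<lambda>a. (a, Suc m - a)) ` {..Suc m}"
  have *: "{(a, b :: nat). a + b \<le> Suc m} = {(a, b). a + b \<le> m} \<union> ?D"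
    by (auto simp: image_iff)
  have "card ?D = m + 2" by (subst card_image) (auto intro: inj_onI)
  moreover have "{(a, b). a + b \<le> m} \<inter> ?D = {}" by auto
  ultimately have "card {(a, b :: nat). a + b \<le> Suc m} = ((m + 2) choose 2) + (m + 2)"
    unfolding * using Suc by (subst card_Un_disjoint) auto
  moreover have "(Suc m + 2) choose 2 = ((m + 2) choose 2) + (m + 2)"
    by (simp add: numeral_2_eq_2)
  ultimately show ?case unfolding * using Suc by simp
qed

text \<open>The monomials x_1^a x_2^b with a + b \<le> m are independent on the cone: their images
  have exponents a + b and a + 2b, which determine a and b. Slope 1 suffices.\<close>

lemma growth_curve_ideal:
  assumes V: "{1, 2} \<subseteq> V"
  shows "growth V (curve_ideal V :: ('k::field) mpoly set) 2"
  unfolding growth_def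
proof (intro exI[of _ 1] allI)
  fix m
  let ?S = "{(a, b :: nat). a + b \<le> m}"
  let ?e = "\<lambda>(a, b). Poly_Mapping.single 1 a + Poly_Mapping.single 2 b :: nat \<Rightarrow>\<^sub>0 nat"
  let ?f = "\<lambda>s. Poly_Mapping.single (?e s) (1 :: 'k)"
  have fin: "finite ?S" using card_pairs_sum_le by blast
  have curve: "curve_exp (?e (a, b)) = Poly_Mapping.single 0 (a + b) + Poly_Mapping.single 1 (a + 2 * b)"
    for a b
    by (simp add: curve_exp_add curve_exp_single single_add algebra_simps)
  have "inj (curve_exp \<circ> ?e)"
  proof (rule injI, clarify)
    fix a b a' b' assume "(curve_exp \<circ> ?e) (a, b) = (curve_exp \<circ> ?e) (a', b')"
    hence eq: "Poly_Mapping.single 0 (a + b) + Poly_Mapping.single 1 (a + 2 * b) =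
        Poly_Mapping.single (0::nat) (a' + b') + Poly_Mapping.single 1 (a' + 2 * b')"
      unfolding o_apply curve .
    from arg_cong[OF eq, of "\<lambda>p. Poly_Mapping.lookup p 0"]
      arg_cong[OF eq, of "\<lambda>p. Poly_Mapping.lookup p 1"]
    show "a = a' \<and> b = b'" by (simp add: lookup_add lookup_single)
  qed
  hence inj_ce: "curve_exp (?e s) = curve_exp (?e t) \<longleftrightarrow> s = t" for s t
    using inj_eq[of "curve_exp \<circ> ?e" s t] unfolding o_apply by blast
  have inj: "inj_on ?f ?S"
  proof (rule inj_onI)
    fix s t assume "?f s = ?f t"
    hence "?e s = ?e t" by (metis keys_single singleton_inject zero_neq_one)
    thus "s = t" using inj_ce by metis
  qed
  have indep: "indep_mod (curve_ideal V) (?f ` ?S)"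
    unfolding indep_mod_def
  proof (intro conjI allI impI ballI)
    show "finite (?f ` ?S)" using fin by simp
    fix c b assume c: "(\<Sum>b\<in>?f ` ?S. cmult (c b) b) \<in> curve_ideal V" and "b \<in> ?f ` ?S"
    then obtain t where t: "t \<in> ?S" "b = ?f t" by blast
    have "(\<Sum>b\<in>?f ` ?S. cmult (c b) b) = (\<Sum>s\<in>?S. Poly_Mapping.single (?e s) (c (?f s)))"
      using inj by (simp add: sum.reindex)
    hence "0 = (\<Sum>s\<in>?S. Poly_Mapping.single (curve_exp (?e s)) (c (?f s)))"
      using c by (simp add: curve_ideal_def monom_subst_sum)
    hence "0 = Poly_Mapping.lookup (\<Sum>s\<in>?S. Poly_Mapping.single (curve_exp (?e s)) (c (?f s)))
        (curve_exp (?e t))" by simp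
    also have "\<dots> = (\<Sum>s\<in>?S. if s = t then c (?f s) else 0)"
      unfolding lookup_sum lookup_single inj_ce when_def ..
    also have "\<dots> = c (?f t)" using fin t(1) by (simp add: sum.delta')
    finally show "c b = 0" unfolding t(2) ..
  qed
  have "?f ` ?S \<subseteq> polys V"
    using V by (fastforce simp: polys_iff dest: subsetD[OF Poly_Mapping.keys_add] split: if_splits)
  moreover have "\<forall>b\<in>?f ` ?S. deg_le (1 * m) b"
    by (auto simp: deg_le_def monom_degree_add)
  moreover have "card (?f ` ?S) = (m + 2) choose 2"
    using card_image[OF inj] card_pairs_sum_le by simp
  ultimately show "\<exists>B. B \<subseteq> polys V \<and> (\<forall>b\<in>B. deg_le (1 * m) b) \<and>
      indep_mod (curve_ideal V :: 'k mpoly set) B \<and> card B = (m + 2) choose 2"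
    using indep by blast
qed

section \<open>Minimal homogeneous generators\<close>

definition hom_component :: "nat \<Rightarrow> ('k::comm_ring_1) mpoly \<Rightarrow> 'k mpoly" where
  "hom_component d p = (\<Sum>\<mu> | \<mu> \<in> Poly_Mapping.keys p \<and> monom_degree \<mu> = d.
     Poly_Mapping.single \<mu> (Poly_Mapping.lookup p \<mu>))"

definition forms :: "nat \<Rightarrow> ('k::comm_ring_1) mpoly set" where
  "forms d = {p. \<forall>\<mu> \<in> Poly_Mapping.keys p. monom_degree \<mu> = d}"

definition deg_ge :: "nat \<Rightarrow> ('k::comm_ring_1) mpoly \<Rightarrow> bool" where
  "deg_ge d p \<longleftrightarrow> (\<forall>\<mu> \<in> Poly_Mapping.keys p. d \<le> monom_degree \<mu>)"

lemma lookup_hom_component: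
  "Poly_Mapping.lookup (hom_component d p) \<mu> = (if monom_degree \<mu> = d then Poly_Mapping.lookup p \<mu> else 0)"
proof -
  have "Poly_Mapping.lookup (hom_component d p) \<mu> =
      (\<Sum>\<nu> | \<nu> \<in> Poly_Mapping.keys p \<and> monom_degree \<nu> = d. if \<nu> = \<mu> then Poly_Mapping.lookup p \<nu> else 0)"
    by (simp add: hom_component_def lookup_sum lookup_single when_def)
  thus ?thesis by (simp add: sum.delta' in_keys_iff)
qed

lemma hom_component_zero [simp]: "hom_component d 0 = 0"
  and hom_component_add: "hom_component d (p + q) = hom_component d p + hom_component d q"
  by (rule poly_mapping_eqI, simp add: lookup_hom_component lookup_add)+

lemma lookup_cmult: "Poly_Mapping.lookup (cmult c p) \<mu> = c * Poly_Mapping.lookup p \<mu>"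
proof -
  have "cmult c p = (\<Sum>\<nu>\<in>Poly_Mapping.keys p. Poly_Mapping.single \<nu> (c * Poly_Mapping.lookup p \<nu>))"
    by (subst (1) sum_monomials[of "Poly_Mapping.keys p" p, symmetric])
      (simp_all add: mpoly.scale_sum_right)
  thus ?thesis by (simp add: lookup_sum lookup_single when_def sum.delta' in_keys_iff)
qed

lemma hom_component_cmult: "hom_component d (cmult c p) = cmult c (hom_component d p)"
  by (rule poly_mapping_eqI) (simp add: lookup_hom_component lookup_cmult)

lemma hom_component_eq_0: "(\<And>\<mu>. \<mu> \<in> Poly_Mapping.keys p \<Longrightarrow> monom_degree \<mu> \<noteq> d) \<Longrightarrow> hom_component d p = 0"
  by (rule poly_mapping_eqI) (auto simp: lookup_hom_component in_keys_iff)

lemma hom_component_form: "p \<in> forms d \<Longrightarrow> hom_component d p = p"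
  by (rule poly_mapping_eqI) (auto simp: lookup_hom_component forms_def in_keys_iff)

lemma deg_ge_mult:
  fixes p q :: "('k::comm_ring_1) mpoly"
  assumes "deg_ge d p" "deg_ge e q"
  shows "deg_ge (d + e) (p * q)"
  using assms keys_mult[of p q] unfolding deg_ge_def
  by (fastforce simp: monom_degree_add intro: add_mono)

text \<open>If p starts in degree d, every non-constant monomial of r pushes p beyond degree d, so
  only the constant term of r contributes.\<close>

lemma hom_component_mult:
  fixes p r :: "('k::field) mpoly"
  assumes "deg_ge d p"
  shows "hom_component d (r * p) = cmult (Poly_Mapping.lookup r 0) (hom_component d p)"
proof -
  let ?r0 = "Poly_Mapping.single 0 (Poly_Mapping.lookup r 0)"
  let ?r = "r - ?r0"
  have "deg_ge 1 ?r"
    unfolding deg_ge_def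
  proof
    fix \<mu> assume "\<mu> \<in> Poly_Mapping.keys ?r"
    hence "\<mu> \<noteq> 0" by (auto simp: in_keys_iff lookup_minus)
    thus "1 \<le> monom_degree \<mu>" using monom_degree_eq_0_iff[of \<mu>] by linarith
  qed
  hence "deg_ge (1 + d) (?r * p)" using assms by (rule deg_ge_mult)
  hence "hom_component d (?r * p) = 0"
    by (intro hom_component_eq_0) (auto simp: deg_ge_def)
  moreover have "r * p = ?r * p + cmult (Poly_Mapping.lookup r 0) p"
    by (simp add: cmult_def algebra_simps)
  ultimately show ?thesis by (simp add: hom_component_add hom_component_cmult)
qed

section \<open>Ideals generated by forms\<close>

lemma Idl_mpoly_ring:
  fixes B :: "('k::comm_ring_1) mpoly set"
  assumes "B \<subseteq> polys V"
  shows "ideal (Idl\<^bsub>mpoly_ring V\<^esub> B) (mpoly_ring V)" "B \<subseteq> Idl\<^bsub>mpoly_ring V\<^esub> B"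
    "\<And>I. ideal I (mpoly_ring V) \<Longrightarrow> B \<subseteq> I \<Longrightarrow> Idl\<^bsub>mpoly_ring V\<^esub> B \<subseteq> I"
proof -
  interpret cring "mpoly_ring V :: 'k mpoly ring" by (rule mpoly_ring_cring)
  show "ideal (Idl\<^bsub>mpoly_ring V\<^esub> B) (mpoly_ring V)" "B \<subseteq> Idl\<^bsub>mpoly_ring V\<^esub> B"
    "\<And>I. ideal I (mpoly_ring V) \<Longrightarrow> B \<subseteq> I \<Longrightarrow> Idl\<^bsub>mpoly_ring V\<^esub> B \<subseteq> I"
    using genideal_ideal[OF assms] genideal_self[OF assms] genideal_minimal by auto
qed

lemma span_subset_Idl:
  assumes "B \<subseteq> polys V"
  shows "mpoly.span B \<subseteq> Idl\<^bsub>mpoly_ring V\<^esub> B"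
proof (rule mpoly.span_minimal)
  show "B \<subseteq> Idl\<^bsub>mpoly_ring V\<^esub> B" by (rule Idl_mpoly_ring[OF assms])
  show "mpoly.subspace (Idl\<^bsub>mpoly_ring V\<^esub> B)"
    using Idl_mpoly_ring(1)[OF assms] ideal_cmult[OF Idl_mpoly_ring(1)[OF assms]]
    by (auto simp: mpoly.subspace_def ideal_mpoly_ring_iff)
qed

text \<open>The core of graded Nakayama: in the lowest degree, ideal membership is linear algebra
  over the coefficient field. The polynomials satisfying the conclusion form an ideal that contains
  B.\<close>

lemma hom_component_Idl:
  fixes B :: "('k::field) mpoly set"
  assumes B: "B \<subseteq> polys V" "\<And>b. b \<in> B \<Longrightarrow> homogeneous b" "\<And>b. b \<in> B \<Longrightarrow> deg_ge d b"
    and p: "p \<in> Idl\<^bsub>mpoly_ring V\<^esub> B"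
  shows "deg_ge d p" "hom_component d p \<in> mpoly.span (B \<inter> forms d)"
proof -
  let ?X = "{p \<in> polys V. deg_ge d p \<and> hom_component d p \<in> mpoly.span (B \<inter> forms d)}"
  have "ideal ?X (mpoly_ring V)"
    unfolding ideal_mpoly_ring_iff
  proof (intro conjI ballI)
    show "0 \<in> ?X" by (simp add: deg_ge_def mpoly.span_zero)
  next
    fix p q assume "p \<in> ?X" "q \<in> ?X"
    moreover have "deg_ge d (p + q)" if "deg_ge d p" "deg_ge d q"
      using that Poly_Mapping.keys_add[of p q] by (auto simp: deg_ge_def)
    ultimately show "p + q \<in> ?X"
      by (simp add: polys_add hom_component_add mpoly.span_add)
  next
    fix p r :: "'k mpoly" assume p: "p \<in> ?X" and r: "r \<in> polys V"
    have "deg_ge (0 + d) (r * p)" using p by (intro deg_ge_mult) (auto simp: deg_ge_def)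
    thus "r * p \<in> ?X"
      using p r by (simp add: polys_mult hom_component_mult mpoly.span_scale)
  qed auto
  moreover have "B \<subseteq> ?X"
  proof
    fix b assume b: "b \<in> B"
    obtain e where e: "b \<in> forms e" using B(2)[OF b] by (auto simp: homogeneous_def forms_def)
    have "hom_component d b \<in> mpoly.span (B \<inter> forms d)"
    proof (cases "e = d")
      case True
      thus ?thesis using e b by (simp add: hom_component_form mpoly.span_base)
    next
      case False
      hence "hom_component d b = 0" using e by (intro hom_component_eq_0) (auto simp: forms_def)
      thus ?thesis by (simp add: mpoly.span_zero)
    qed
    thus "b \<in> ?X" using b B by auto
  qed
  ultimately have "Idl\<^bsub>mpoly_ring V\<^esub> B \<subseteq> ?X" by (rule Idl_mpoly_ring(3)[OF B(1)])
  thus "deg_ge d p" "hom_component d p \<in> mpoly.span (B \<inter> forms d)" using p by auto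
qed

lemma forms_homogeneous: "p \<in> forms d \<Longrightarrow> homogeneous p"
  and forms_deg_ge: "p \<in> forms d \<Longrightarrow> deg_ge d p"
  by (auto simp: forms_def homogeneous_def deg_ge_def)

text \<open>In degree d, any homogeneous generating set must span the space spanned by S. A minimal
  one has nothing outside degree d and no linear redundancy, so it is a basis of that space, as S
  is.\<close>

lemma num_min_gens_Idl_forms:
  fixes S :: "('k::field) mpoly set"
  assumes S: "finite S" "S \<subseteq> polys V" "S \<subseteq> forms d" "\<not> mpoly.dependent S"
  shows "num_min_gens (mpoly_ring V) (Idl\<^bsub>mpoly_ring V\<^esub> S) = card S"
  unfolding num_min_gens_def
proof (rule the_equality)
  let ?I = "Idl\<^bsub>mpoly_ring V\<^esub> S"
  have hom: "homogeneous s" "deg_ge d s" if "s \<in> S" for s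
    using that S(3) forms_homogeneous forms_deg_ge by blast+
  have "minimal_homogeneous_gens (mpoly_ring V) ?I S"
    unfolding minimal_homogeneous_gens_def
  proof (intro conjI allI impI ballI notI)
    fix C assume C: "C \<subset> S" "Idl\<^bsub>mpoly_ring V\<^esub> C = ?I"
    obtain s where s: "s \<in> S" "s \<notin> C" using C by blast
    have "s \<in> Idl\<^bsub>mpoly_ring V\<^esub> C" using Idl_mpoly_ring(2)[OF S(2)] s C(2) by blast
    hence "hom_component d s \<in> mpoly.span (C \<inter> forms d)"
      using C(1) S(2) by (intro hom_component_Idl(2)[of C V]) (auto intro: hom)
    moreover have "hom_component d s = s" using s S(3) by (intro hom_component_form) auto
    moreover have "C \<inter> forms d \<subseteq> S - {s}" using C(1) s by auto
    ultimately have "s \<in> mpoly.span (S - {s})" using mpoly.span_mono by auto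
    thus False using S(4) s(1) unfolding mpoly.dependent_def by blast
  qed (use S hom in auto)
  thus "\<exists>B. minimal_homogeneous_gens (mpoly_ring V) ?I B \<and> card B = card S" by blast
next
  let ?I = "Idl\<^bsub>mpoly_ring V\<^esub> S"
  have hom: "homogeneous s" "deg_ge d s" if "s \<in> S" for s
    using that S(3) forms_homogeneous forms_deg_ge by blast+
  fix k assume "\<exists>B. minimal_homogeneous_gens (mpoly_ring V) ?I B \<and> card B = k"
  then obtain B where B: "finite B" "B \<subseteq> polys V" "\<And>b. b \<in> B \<Longrightarrow> homogeneous b"
    "Idl\<^bsub>mpoly_ring V\<^esub> B = ?I" "\<And>C. C \<subset> B \<Longrightarrow> Idl\<^bsub>mpoly_ring V\<^esub> C \<noteq> ?I" "card B = k"
    unfolding minimal_homogeneous_gens_def by blast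
  have BI: "B \<subseteq> ?I" using Idl_mpoly_ring(2)[OF B(2)] B(4) by simp
  have SI: "S \<subseteq> Idl\<^bsub>mpoly_ring V\<^esub> B" using Idl_mpoly_ring(2)[OF S(2)] B(4) by simp
  have degB: "deg_ge d b" if "b \<in> B" for b
    using that BI hom_component_Idl(1)[OF S(2) hom, of b] by blast
  have gens: "Idl\<^bsub>mpoly_ring V\<^esub> C = ?I" if C: "C \<subseteq> B" "S \<subseteq> mpoly.span C" for C
  proof
    have CV: "C \<subseteq> polys V" using C B(2) by blast
    have "S \<subseteq> Idl\<^bsub>mpoly_ring V\<^esub> C" using span_subset_Idl[OF CV] C(2) by blast
    thus "?I \<subseteq> Idl\<^bsub>mpoly_ring V\<^esub> C" using Idl_mpoly_ring(3)[OF S(2)] Idl_mpoly_ring(1)[OF CV] by blast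
    show "Idl\<^bsub>mpoly_ring V\<^esub> C \<subseteq> ?I"
      using Idl_mpoly_ring(3)[OF CV Idl_mpoly_ring(1)[OF S(2)]] C(1) BI by blast
  qed
  have span: "S \<subseteq> mpoly.span (B \<inter> forms d)"
  proof
    fix s assume s: "s \<in> S"
    hence "hom_component d s \<in> mpoly.span (B \<inter> forms d)"
      using SI by (intro hom_component_Idl(2)[OF B(2,3) degB]) auto
    thus "s \<in> mpoly.span (B \<inter> forms d)" using s S(3) hom_component_form by fastforce
  qed
  \<comment> \<open>The generators of degree d already span S and so generate the ideal; minimality
    excludes all others.\<close>
  hence "B \<inter> forms d = B" using gens[of "B \<inter> forms d"] B(5)[of "B \<inter> forms d"] by blast
  hence Bf: "B \<subseteq> forms d" and SB: "S \<subseteq> mpoly.span B" using span by auto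
  have "b \<in> mpoly.span S" if b: "b \<in> B" for b
  proof -
    have "hom_component d b \<in> mpoly.span (S \<inter> forms d)"
      using BI b by (intro hom_component_Idl(2)[OF S(2) hom]) auto
    moreover have "S \<inter> forms d = S" using S(3) by blast
    ultimately show ?thesis using b Bf hom_component_form by fastforce
  qed
  hence BS: "B \<subseteq> mpoly.span S" by blast
  have "\<not> mpoly.dependent B"
  proof
    assume "mpoly.dependent B"
    then obtain b where b: "b \<in> B" "b \<in> mpoly.span (B - {b})" unfolding mpoly.dependent_def by blast
    hence "mpoly.span (B - {b}) = mpoly.span B"
      using mpoly.span_redundant[of b "B - {b}"] by (simp add: insert_absorb)
    hence "Idl\<^bsub>mpoly_ring V\<^esub> (B - {b}) = ?I" using SB by (intro gens) auto
    thus False using B(5)[of "B - {b}"] b(1) by blast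
  qed
  hence "card B \<le> card S" using mpoly.independent_span_bound[OF S(1) _ BS] by blast
  moreover have "card S \<le> card B" using mpoly.independent_span_bound[OF B(1) S(4) SB] by blast
  ultimately show "k = card S" using B(6) by simp
qed

section \<open>Cycles in graphs containing the path\<close>

lemma cycle_neighbours:
  assumes "is_cycle C" "v \<in> verts C"
  obtains a b where "a \<noteq> b" "a \<noteq> v" "b \<noteq> v" "a \<in> verts C" "b \<in> verts C" "{v, a} \<in> edges C" "{v, b} \<in> edges C"
proof -
  obtain vs where vs: "distinct vs" "3 \<le> length vs"
    "C = (set vs, {{vs ! i, vs ! (Suc i mod length vs)} | i. i < length vs})"
    using assms(1) unfolding is_cycle_def by blast
  let ?L = "length vs"
  obtain i where i: "i < ?L" "v = vs ! i" using assms(2) vs(3) by (auto simp: in_set_conv_nth)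
  define p where "p = (if i = 0 then ?L - 1 else i - 1)"
  define s where "s = Suc i mod ?L"
  have p: "p < ?L" "Suc p mod ?L = i" "p \<noteq> i" using i vs(2) by (auto simp: p_def)
  have s: "s < ?L" "s \<noteq> i" using i vs(2) by (auto simp: s_def mod_Suc)
  \<comment> \<open>This is where length at least 3 enters: in a closed walk of length 2 predecessor
    and successor coincide.\<close>
  have "p \<noteq> s" using i vs(2) by (auto simp: p_def s_def mod_Suc split: if_splits)
  show ?thesis
  proof (rule that[of "vs ! p" "vs ! s"])
    show "vs ! p \<noteq> vs ! s" "vs ! p \<noteq> v" "vs ! s \<noteq> v"
      using vs(1) i p s \<open>p \<noteq> s\<close> by (auto simp: nth_eq_iff_index_eq)
    show "vs ! p \<in> verts C" "vs ! s \<in> verts C" using p s vs(3) by auto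
    have "{v, vs ! p} = {vs ! p, vs ! (Suc p mod ?L)}" using p i by auto
    thus "{v, vs ! p} \<in> edges C" using p vs(3) by auto
    show "{v, vs ! s} \<in> edges C" using i vs(3) s_def by auto
  qed
qed

lemma is_cycle_edge_subset:
  assumes "is_cycle C" "e \<in> edges C"
  shows "e \<subseteq> verts C"
proof -
  obtain vs where vs: "distinct vs" "3 \<le> length vs"
    "C = (set vs, {{vs ! i, vs ! (Suc i mod length vs)} | i. i < length vs})"
    using assms(1) unfolding is_cycle_def by blast
  obtain i where i: "i < length vs" "e = {vs ! i, vs ! (Suc i mod length vs)}"
    using assms(2) vs(3) by auto
  have "Suc i mod length vs < length vs" using vs(2) by (intro mod_less_divisor) auto
  thus ?thesis using i vs(3) by auto
qed

definition chord_cycle :: "nat \<Rightarrow> nat \<Rightarrow> nat graph" where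
  "chord_cycle t u = ({t..u}, insert {t, u} {{i, i + 1} | i. t \<le> i \<and> i < u})"

lemma is_cycle_chord_cycle:
  assumes "t + 2 \<le> u"
  shows "is_cycle (chord_cycle t u)"
proof -
  define vs where "vs = [t..<Suc u]"
  have L: "length vs = Suc (u - t)" using assms by (simp add: vs_def)
  have nth: "vs ! i = t + i" if "i \<le> u - t" for i
    using that assms unfolding vs_def by (subst nth_upt) auto
  have "{{vs ! i, vs ! (Suc i mod length vs)} | i. i < length vs} =
      insert {t, u} {{i, i + 1} | i. t \<le> i \<and> i < u}" (is "?A = ?B")
  proof
    show "?A \<subseteq> ?B"
    proof
      fix e assume "e \<in> ?A"
      then obtain i where i: "i \<le> u - t" "e = {vs ! i, vs ! (Suc i mod Suc (u - t))}"
        unfolding L less_Suc_eq_le by blast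
      show "e \<in> ?B"
      proof (cases "i = u - t")
        case True
        hence "e = {u, t}" using i nth[of i] nth[of 0] assms by simp
        thus ?thesis by (auto simp: insert_commute)
      next
        case False
        hence "Suc i mod Suc (u - t) = Suc i" using i by simp
        hence "e = {t + i, t + i + 1}" using i False nth[of i] nth[of "Suc i"] by simp
        moreover have "t \<le> t + i" "t + i < u" using i False by auto
        ultimately show ?thesis by blast
      qed
    qed
    show "?B \<subseteq> ?A"
    proof
      fix e assume "e \<in> ?B"
      then consider "e = {t, u}" | i where "e = {i, i + 1}" "t \<le> i" "i < u" by blast
      thus "e \<in> ?A"
      proof cases
        case 1
        hence "e = {vs ! (u - t), vs ! (Suc (u - t) mod length vs)}"
          unfolding L using nth[of "u - t"] nth[of 0] assms by (simp add: insert_commute)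
        thus ?thesis unfolding L by blast
      next
        case 2
        hence "Suc (i - t) mod length vs = Suc (i - t)" unfolding L by simp
        moreover have "vs ! (i - t) = i" "vs ! Suc (i - t) = i + 1"
          using nth[of "i - t"] nth[of "Suc (i - t)"] 2 by auto
        ultimately have "e = {vs ! (i - t), vs ! (Suc (i - t) mod length vs)}"
          using 2 by simp
        moreover have "i - t < length vs" unfolding L using 2 by simp
        ultimately show ?thesis by blast
      qed
    qed
  qed
  hence "chord_cycle t u = (set vs, {{vs ! i, vs ! (Suc i mod length vs)} | i. i < length vs})"
    using assms by (simp add: chord_cycle_def vs_def atLeastLessThanSuc_atLeastAtMost del: upt_Suc)
  moreover have "distinct vs" by (simp add: vs_def del: upt_Suc)
  ultimately show ?thesis unfolding is_cycle_def using L assms by (intro exI[of _ vs]) simp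
qed

lemma edges_path_graph_iff:
  "{a, b} \<in> edges (path_graph n) \<longleftrightarrow> (b = a + 1 \<or> a = b + 1) \<and> 1 \<le> min a b \<and> max a b \<le> n"
  by (auto simp: path_graph_def doubleton_eq_iff intro: exI[of _ "min a b"])

text \<open>The largest and the smallest vertex of a cycle have two neighbours on one side, so they
  are the ends of the added edge; every other vertex is joined to its predecessor and successor.\<close>

lemma unicyclic_path_with_chord:
  assumes "1 \<le> t" "t + 2 \<le> u" "u \<le> n"
  shows "unicyclic ({1..n}, insert {t, u} (edges (path_graph n)))" (is "unicyclic ?G")
  unfolding unicyclic_def
proof (rule ex1I[of _ "chord_cycle t u"], intro conjI)
  show "is_cycle (chord_cycle t u)" using is_cycle_chord_cycle assms by blast
  show "subgraph (chord_cycle t u) ?G"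
    using assms by (auto simp: subgraph_def chord_cycle_def path_graph_def)
  fix C assume "is_cycle C \<and> subgraph C ?G"
  hence C: "is_cycle C" and sub: "subgraph C ?G" by auto
  have adj: "b = a + 1 \<or> a = b + 1 \<or> a = t \<and> b = u \<or> a = u \<and> b = t" if "{a, b} \<in> edges C" for a b
  proof -
    have "{a, b} = {t, u} \<or> {a, b} \<in> edges (path_graph n)"
      using that sub by (auto simp: subgraph_def)
    thus ?thesis unfolding edges_path_graph_iff by (auto simp: doubleton_eq_iff)
  qed
  have ne: "verts C \<noteq> {}" using C unfolding is_cycle_def by force
  have fin: "finite (verts C)" using C unfolding is_cycle_def by force
  define M where "M = Max (verts C)"
  define m where "m = Min (verts C)"
  have M: "M \<in> verts C" "\<And>v. v \<in> verts C \<Longrightarrow> v \<le> M" using fin ne by (simp_all add: M_def)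
  have m: "m \<in> verts C" "\<And>v. v \<in> verts C \<Longrightarrow> m \<le> v" using fin ne by (simp_all add: m_def)
  have Mu: "M = u \<and> {u, t} \<in> edges C"
  proof -
    obtain a b where ab: "a \<noteq> b" "a \<noteq> M" "b \<noteq> M" "a \<in> verts C" "b \<in> verts C"
      "{M, a} \<in> edges C" "{M, b} \<in> edges C"
      using cycle_neighbours[OF C M(1)] by blast
    have "a < M" "b < M" using ab M(2) by (simp_all add: le_neq_implies_less)
    thus ?thesis using adj[OF ab(6)] adj[OF ab(7)] ab assms by auto
  qed
  have mt: "m = t"
  proof -
    obtain a b where ab: "a \<noteq> b" "a \<noteq> m" "b \<noteq> m" "a \<in> verts C" "b \<in> verts C"
      "{m, a} \<in> edges C" "{m, b} \<in> edges C"
      using cycle_neighbours[OF C m(1)] by blast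
    have "m < a" "m < b" using ab m(2) by (simp_all add: le_neq_implies_less)
    thus ?thesis using adj[OF ab(6)] adj[OF ab(7)] ab assms by auto
  qed
  have succ: "v + 1 \<in> verts C \<and> {v, v + 1} \<in> edges C" if v: "v \<in> verts C" "v < u" for v
  proof -
    obtain a b where ab: "a \<noteq> b" "a \<noteq> v" "b \<noteq> v" "a \<in> verts C" "b \<in> verts C"
      "{v, a} \<in> edges C" "{v, b} \<in> edges C"
      using cycle_neighbours[OF C v(1)] by blast
    have ge: "t \<le> a" "t \<le> b" using ab m(2) mt by auto
    have "a = v + 1 \<or> b = v + 1"
      using adj[OF ab(6)] adj[OF ab(7)] ab(1) ge v(2) by auto
    thus ?thesis using ab by auto
  qed
  have all: "v \<in> verts C" if "t \<le> v" "v \<le> u" for v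
    using that
  proof (induction v rule: dec_induct)
    case base
    thus ?case using m mt by simp
  next
    case (step v)
    thus ?case using succ[of v] by simp
  qed
  have verts: "verts C = {t..u}"
  proof
    show "verts C \<subseteq> {t..u}" using M(2) Mu m(2) mt by (simp add: subset_iff)
    show "{t..u} \<subseteq> verts C" using all by (simp add: subset_iff)
  qed
  have "edges C = insert {t, u} {{i, i + 1} | i. t \<le> i \<and> i < u}"
  proof
    show "insert {t, u} {{i, i + 1} | i. t \<le> i \<and> i < u} \<subseteq> edges C"
      using Mu succ unfolding verts by (fastforce simp: insert_commute)
    show "edges C \<subseteq> insert {t, u} {{i, i + 1} | i. t \<le> i \<and> i < u}"
    proof
      fix e assume e: "e \<in> edges C"
      hence "e = {t, u} \<or> (\<exists>i. e = {i, i + 1})" using sub by (auto simp: subgraph_def path_graph_def)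
      thus "e \<in> insert {t, u} {{i, i + 1} | i. t \<le> i \<and> i < u}"
        using is_cycle_edge_subset[OF C e] verts by auto
    qed
  qed
  thus "C = chord_cycle t u" using verts by (simp add: chord_cycle_def prod_eq_iff)
qed

section \<open>Graphs with exactly n edges\<close>

lemma card_edges_path_graph: "card (edges (path_graph n)) = n - 1" and
  finite_edges_path_graph: "finite (edges (path_graph n))"
proof -
  have eq: "edges (path_graph n) = (\<lambda>i. {i, i + 1}) ` {1..<n}"
    by (auto simp: path_graph_def)
  show "finite (edges (path_graph n))" unfolding eq by simp
  have "inj_on (\<lambda>i::nat. {i, i + 1}) {1..<n}" by (auto simp: inj_on_def doubleton_eq_iff)
  thus "card (edges (path_graph n)) = n - 1" unfolding eq by (simp add: card_image)
qed

lemma cycle_graph_eq: "cycle_graph n = ({1..n}, insert {1, n} (edges (path_graph n)))"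
  by (simp add: cycle_graph_def path_graph_def)

lemma finite_edges: "simple_graph G \<Longrightarrow> finite (edges G)"
  unfolding simple_graph_def by (rule finite_subset[of _ "Pow (verts G)"]) auto

lemma simple_graph_eqI_card:
  assumes "simple_graph G" "verts G = verts H" "edges H \<subseteq> edges G" "card (edges G) = card (edges H)"
  shows "G = H"
  using assms card_subset_eq[OF finite_edges[OF assms(1)], of "edges H"] by (simp add: prod_eq_iff)

lemma hamiltonian_card_edges_iff:
  assumes G: "simple_graph G" "verts G = {1..n}" and "labeled_hamiltonian n G"
  shows "card (edges G) = n \<longleftrightarrow> G = cycle_graph n"
proof -
  have n: "3 \<le> n" and sub: "edges (cycle_graph n) \<subseteq> edges G"
    using assms(3) by (auto simp: labeled_hamiltonian_def subgraph_def)
  have "{1, n} \<notin> edges (path_graph n)" unfolding edges_path_graph_iff using n by simp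
  hence "card (edges (cycle_graph n)) = n"
    using n by (simp add: cycle_graph_eq card_edges_path_graph finite_edges_path_graph)
  thus ?thesis
    using simple_graph_eqI_card[OF G(1) _ sub] G(2) by (auto simp: cycle_graph_eq)
qed

text \<open>The path uses n - 1 edges, so exactly one is left over; as it is not a path edge, its
  ends differ by at least 2.\<close>

lemma semi_hamiltonian_card_edges_iff:
  assumes G: "simple_graph G" "verts G = {1..n}" and n: "1 \<le> n" and "subgraph (path_graph n) G"
  shows "card (edges G) = n \<longleftrightarrow>
    (\<exists>t s. 1 \<le> t \<and> t + 2 \<le> n \<and> 2 \<le> s \<and> t + s \<le> n \<and>
      G = (verts (path_graph n), insert {t, t + s} (edges (path_graph n))))"
    (is "_ \<longleftrightarrow> ?R")
proof
  let ?E = "edges (path_graph n)"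
  have sub: "?E \<subseteq> edges G" using assms(4) by (simp add: subgraph_def)
  have V: "verts (path_graph n) = {1..n}" by (simp add: path_graph_def)
  assume card: "card (edges G) = n"
  hence "card (edges G - ?E) = 1"
    using sub n finite_edges_path_graph by (simp add: card_Diff_subset card_edges_path_graph)
  then obtain e where e: "edges G - ?E = {e}" using card_1_singletonE by blast
  hence eG: "edges G = insert e ?E" "e \<in> edges G" "e \<notin> ?E" using sub by blast+
  have "\<exists>a b. a \<in> verts G \<and> b \<in> verts G \<and> a \<noteq> b \<and> e = {a, b}"
    using G(1) eG(2) unfolding simple_graph_def by blast
  then obtain a b where ab: "a \<in> {1..n}" "b \<in> {1..n}" "a \<noteq> b" "e = {a, b}"
    unfolding G(2) by blast
  have "\<exists>t u. t < u \<and> 1 \<le> t \<and> u \<le> n \<and> e = {t, u}"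
  proof (cases "a < b")
    case True
    thus ?thesis using ab by (intro exI[of _ a] exI[of _ b]) simp
  next
    case False
    thus ?thesis using ab by (intro exI[of _ b] exI[of _ a]) (simp add: insert_commute)
  qed
  then obtain t u where tu: "t < u" "1 \<le> t" "u \<le> n" "e = {t, u}" by blast
  have "u \<noteq> t + 1" using eG(3) tu unfolding tu(4) edges_path_graph_iff by auto
  hence "t + 2 \<le> u" using tu by simp
  then obtain s where s: "u = t + s" "2 \<le> s" using le_Suc_ex by fastforce
  have "G = (verts (path_graph n), insert {t, t + s} ?E)"
    using G(2) eG(1) tu(4) s(1) V by (simp add: prod_eq_iff)
  thus ?R using tu s by (intro exI[of _ t] exI[of _ s]) simp
next
  assume ?R
  then obtain t s where ts: "1 \<le> t" "2 \<le> s" "t + s \<le> n"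
    "G = (verts (path_graph n), insert {t, t + s} (edges (path_graph n)))" by blast
  have "{t, t + s} \<notin> edges (path_graph n)" unfolding edges_path_graph_iff using ts by auto
  hence "card (edges G) = Suc (n - 1)"
    by (subst ts(4)) (simp add: card_edges_path_graph finite_edges_path_graph)
  thus "card (edges G) = n" using n by simp
qed

section \<open>Hankel edge ideals\<close>

lemma single_add_single_eq_iff:
  fixes a b c d :: nat
  shows "Poly_Mapping.single a 1 + Poly_Mapping.single b 1 =
      Poly_Mapping.single c 1 + (Poly_Mapping.single d 1 :: nat \<Rightarrow>\<^sub>0 nat) \<longleftrightarrow>
    a = c \<and> b = d \<or> a = d \<and> b = c"
proof
  assume eq: "Poly_Mapping.single a 1 + Poly_Mapping.single b 1 =
      Poly_Mapping.single c 1 + (Poly_Mapping.single d 1 :: nat \<Rightarrow>\<^sub>0 nat)"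
  have "(1 when a = x) + (1 when b = x) = (1 when c = x) + ((1 :: nat) when d = x)" for x
    using arg_cong[OF eq, of "\<lambda>p. Poly_Mapping.lookup p x"] by (simp add: lookup_add lookup_single)
  from this[of a] this[of b] this[of c] this[of d]
  show "a = c \<and> b = d \<or> a = d \<and> b = c" by (auto simp: when_def split: if_splits)
qed (auto simp: add.commute)

lemma Var_mult_Var: "Var a * Var b = Poly_Mapping.single (Poly_Mapping.single a 1 + Poly_Mapping.single b 1) 1"
  by (simp add: Var_def mult_single)

text \<open>The monomial x_i x_(j+1) is the first term of g_ij and otherwise occurs only as the
  second term of g_kl with k = i - 1 and l = j + 1.\<close>

lemma lookup_hankel_minor:
  assumes "i < j" "k < l"
  shows "Poly_Mapping.lookup (hankel_minor k l :: ('k::comm_ring_1) mpoly)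
      (Poly_Mapping.single i 1 + Poly_Mapping.single (j + 1) 1) =
    (if (k, l) = (i, j) then 1 else if k + 1 = i \<and> l = j + 1 then -1 else 0)"
  unfolding hankel_minor_def Var_mult_Var lookup_minus lookup_single single_add_single_eq_iff when_def
  using assms by auto

text \<open>If equal minors had different indices, the leading monomial of each would be the second
  term of the other, forcing both k + 1 = i and i + 1 = k.\<close>

lemma hankel_minor_inj:
  assumes "i < j" "k < l" "(hankel_minor i j :: ('k::comm_ring_1) mpoly) = hankel_minor k l"
  shows "i = k \<and> j = l"
proof (rule ccontr)
  assume neq: "\<not> ?thesis"
  have "k + 1 = i \<and> l = j + 1"
    using lookup_hankel_minor[OF assms(1,2), where 'k = 'k]
      lookup_hankel_minor[OF assms(1,1), where 'k = 'k] assms(3) neq by (auto split: if_splits)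
  moreover have "i + 1 = k \<and> j = l + 1"
    using lookup_hankel_minor[OF assms(2,1), where 'k = 'k]
      lookup_hankel_minor[OF assms(2,2), where 'k = 'k] assms(3) neq by (auto split: if_splits)
  ultimately show False by simp
qed

text \<open>The system is triangular in the first index: besides g_ij, the monomial x_i x_(j+1)
  appears only in a minor with first index i - 1, whose coefficient vanishes by induction.\<close>

lemma hankel_minors_sum_eq_0:
  fixes c :: "nat \<times> nat \<Rightarrow> 'k::field"
  assumes A: "finite A" "\<And>i j. (i, j) \<in> A \<Longrightarrow> i < j"
    and 0: "(\<Sum>(i, j)\<in>A. cmult (c (i, j)) (hankel_minor i j)) = 0"
  shows "(i, j) \<in> A \<Longrightarrow> c (i, j) = 0"
proof (induction i arbitrary: j rule: less_induct)
  case (less i)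
  let ?\<mu> = "Poly_Mapping.single i 1 + Poly_Mapping.single (j + 1) 1"
  let ?g = "\<lambda>(k, l). c (k, l) * Poly_Mapping.lookup (hankel_minor k l) ?\<mu>"
  have "0 = Poly_Mapping.lookup (\<Sum>(k, l)\<in>A. cmult (c (k, l)) (hankel_minor k l)) ?\<mu>"
    using 0 by simp
  also have "\<dots> = sum ?g A"
    unfolding lookup_sum by (rule sum.cong) (auto simp: lookup_cmult)
  also have "\<dots> = sum ?g {(i, j)}"
  proof (rule sum.mono_neutral_right)
    show "\<forall>s\<in>A - {(i, j)}. ?g s = 0"
    proof
      fix s assume "s \<in> A - {(i, j)}"
      then obtain k l where kl: "s = (k, l)" "(k, l) \<in> A" "(k, l) \<noteq> (i, j)" by (cases s) auto
      show "?g s = 0"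
        using lookup_hankel_minor[OF A(2)[OF less.prems] A(2)[OF kl(2)], where 'k = 'k]
          less.IH[of k l] kl by (auto split: if_splits)
    qed
  qed (use A less.prems in auto)
  also have "\<dots> = c (i, j)"
    using lookup_hankel_minor[OF A(2)[OF less.prems] A(2)[OF less.prems], where 'k = 'k] by simp
  finally show ?case by simp
qed

lemma hankel_minor_form: "hankel_minor i j \<in> forms 2"
proof -
  have "Poly_Mapping.keys (hankel_minor i j :: 'a mpoly) \<subseteq>
      {Poly_Mapping.single i 1 + Poly_Mapping.single (j + 1) 1,
       Poly_Mapping.single j 1 + Poly_Mapping.single (i + 1) 1}"
    unfolding hankel_minor_def Var_mult_Var
    by (auto simp: in_keys_iff lookup_minus lookup_single when_def split: if_splits)
  thus ?thesis by (auto simp: forms_def monom_degree_add)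
qed

lemma simple_graph_edgeD:
  "simple_graph G \<Longrightarrow> {i, j} \<in> edges G \<Longrightarrow> i \<in> verts G \<and> j \<in> verts G"
  unfolding simple_graph_def by (metis doubleton_eq_iff)

lemma hankel_minor_edge_in_polys:
  assumes "simple_graph G" "verts G = {1..n}" "{i, j} \<in> edges G"
  shows "hankel_minor i j \<in> polys {1..n + 1}"
proof -
  have "i \<in> {1..n}" "j \<in> {1..n}" using simple_graph_edgeD[OF assms(1,3)] assms(2) by auto
  thus ?thesis unfolding hankel_minor_def by (intro polys_diff polys_mult polys_Var) auto
qed

section \<open>Number of generators and height\<close>

lemma num_min_gens_hankel_edge_ideal:
  assumes G: "simple_graph G" "verts G = {1..n}"
  shows "num_min_gens (hankel_ring n :: ('k::field) mpoly ring) (hankel_edge_ideal n G) = card (edges G)"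
proof -
  let ?A = "{(i, j). i < j \<and> {i, j} \<in> edges G}"
  let ?h = "\<lambda>(i, j). hankel_minor i j :: 'k mpoly"
  have edge: "i \<in> {1..n} \<and> j \<in> {1..n}" if "{i, j} \<in> edges G" for i j
    using simple_graph_edgeD[OF G(1) that] G(2) by simp
  hence fin: "finite ?A" by (intro finite_subset[of ?A "{1..n} \<times> {1..n}"]) auto
  have inj: "inj_on ?h ?A" by (rule inj_onI) (auto dest: hankel_minor_inj)
  have gens: "{hankel_minor i j | i j. i < j \<and> {i, j} \<in> edges G} = ?h ` ?A" by auto
  have "\<not> mpoly.dependent (?h ` ?A)"
  proof
    assume "mpoly.dependent (?h ` ?A)"
    then obtain u v where u: "v \<in> ?h ` ?A" "u v \<noteq> 0" "(\<Sum>b\<in>?h ` ?A. cmult (u b) b) = 0"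
      using mpoly.dependent_finite[of "?h ` ?A"] fin by blast
    have "(\<Sum>(i, j)\<in>?A. cmult (u (?h (i, j))) (hankel_minor i j)) = 0"
      using u(3) inj by (simp add: sum.reindex case_prod_beta')
    thus False using hankel_minors_sum_eq_0[OF fin, of "\<lambda>s. u (?h s)"] u(1,2) by auto
  qed
  moreover have "?h ` ?A \<subseteq> polys {1..n + 1}"
    using hankel_minor_edge_in_polys[OF G] by auto
  moreover have "?h ` ?A \<subseteq> forms 2" using hankel_minor_form by auto
  ultimately have "num_min_gens (hankel_ring n :: 'k mpoly ring) (hankel_edge_ideal n G) = card (?h ` ?A)"
    unfolding hankel_ring_def hankel_edge_ideal_def gens using fin
    by (intro num_min_gens_Idl_forms) auto
  also have "\<dots> = card ?A" by (rule card_image[OF inj])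
  also have "\<dots> = card (edges G)"
  proof (rule bij_betw_same_card[of "\<lambda>(i, j). {i, j}"])
    show "bij_betw (\<lambda>(i, j). {i, j}) ?A (edges G)"
      unfolding bij_betw_def
    proof
      show "inj_on (\<lambda>(i, j). {i, j}) ?A" by (auto simp: inj_on_def doubleton_eq_iff)
      have "\<exists>i j. i < j \<and> e = {i, j}" if "e \<in> edges G" for e
      proof -
        obtain u v where uv: "u \<noteq> v" "e = {u, v}" using \<open>e \<in> edges G\<close> G(1) unfolding simple_graph_def by blast
        show ?thesis
        proof (cases "u < v")
          case False
          hence "v < u" "e = {v, u}" using uv by auto
          thus ?thesis by blast
        qed (use uv in blast)
      qed
      thus "(\<lambda>(i, j). {i, j}) ` ?A = edges G" by (fastforce simp: image_iff)
    qed
  qed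
  finally show ?thesis .
qed

lemma ideal_height_hankel_edge_ideal:
  assumes G: "simple_graph G" "verts G = {1..n}" and n: "1 \<le> n" and "subgraph (path_graph n) G"
  shows "ideal_height (hankel_ring n :: ('k::field) mpoly ring) (hankel_edge_ideal n G) = enat (n - 1)"
proof (rule antisym)
  let ?V = "{1..n + 1}" and ?I = "hankel_edge_ideal n G :: 'k mpoly set"
  let ?R = "hankel_ring n :: 'k mpoly ring"
  let ?S = "{hankel_minor i j | i j. i < j \<and> {i, j} \<in> edges G} :: 'k mpoly set"
  have edge: "i \<in> {1..n} \<and> j \<in> {1..n}" if "{i, j} \<in> edges G" for i j
    using simple_graph_edgeD[OF G(1) that] G(2) by simp
  have SV: "?S \<subseteq> polys ?V"
    using hankel_minor_edge_in_polys[OF G] by auto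
  have I: "?I = Idl\<^bsub>mpoly_ring ?V\<^esub> ?S" by (simp add: hankel_edge_ideal_def hankel_ring_def)
  let ?P = "curve_ideal ?V :: 'k mpoly set"
  have P: "primeideal ?P ?R" unfolding hankel_ring_def by (rule primeideal_curve_ideal)
  have "?S \<subseteq> ?P" using edge by (force intro!: hankel_minor_in_curve_ideal)
  hence "?I \<subseteq> ?P"
    unfolding I using P by (intro Idl_mpoly_ring(3)[OF SV]) (auto simp: hankel_ring_def primeideal_mpoly_ring_iff)
  hence "ideal_height ?R ?I \<le> prime_height ?R ?P"
    unfolding ideal_height_def using P by (intro Inf_lower) blast
  also have "prime_height ?R ?P \<le> enat (n - 1)"
    unfolding prime_height_def
  proof (rule Sup_least)
    fix h assume "h \<in> {enat k |k. \<exists>c. (\<forall>i\<le>k. primeideal (c i) ?R) \<and> (\<forall>i<k. c i \<subset> c (Suc i)) \<and> c k = ?P}"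
    then obtain k and c :: "nat \<Rightarrow> 'k mpoly set" where k: "h = enat k" and c: "\<forall>i\<le>k. primeideal (c i) ?R"
      "\<forall>i<k. c i \<subset> c (Suc i)" "c k = ?P" by blast
    have "growth ?V (c k) 2" unfolding c(3) using n by (intro growth_curve_ideal) auto
    \<comment> \<open>There are n + 1 variables, so k + 2 \<le> n + 1.\<close>
    hence "k + 2 \<le> card ?V"
      using c by (intro primeideal_chain_length[of ?V k c]) (auto simp: hankel_ring_def)
    thus "h \<le> enat (n - 1)" using k by simp
  qed
  finally show "ideal_height ?R ?I \<le> enat (n - 1)" .
  show "enat (n - 1) \<le> ideal_height ?R ?I"
    unfolding ideal_height_def
  proof (rule Inf_greatest)
    fix h assume "h \<in> {prime_height ?R P |P. primeideal P ?R \<and> ?I \<subseteq> P}"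
    then obtain P where P: "h = prime_height ?R P" "primeideal P ?R" "?I \<subseteq> P" by blast
    have "consec_minor j \<in> P" if "j < n - 1" for j
    proof -
      have "{j + 1, j + 2} \<in> edges (path_graph n)"
        using that by (auto simp: path_graph_def intro!: exI[of _ "j + 1"])
      hence "(consec_minor j :: 'k mpoly) \<in> ?S"
        using assms(4) unfolding consec_minor_def subgraph_def by force
      thus ?thesis using Idl_mpoly_ring(2)[OF SV] P(3) I by blast
    qed
    \<comment> \<open>For r = n - 1 the chain lemma asks for the variables 1, ..., r + 2, which are
      exactly those of the ring.\<close>
    hence "\<exists>c. (\<forall>i\<le>n-1. primeideal (c i) ?R) \<and> (\<forall>i<n-1. c i \<subset> c (Suc i)) \<and> c (n-1) = P"
      unfolding hankel_ring_def using n P(2)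
      by (intro primeideal_chain_path_ideal) (auto simp: hankel_ring_def)
    thus "enat (n - 1) \<le> h"
      unfolding P(1) prime_height_def by (intro Sup_upper) blast
  qed
qed

theorem proposition2p6:
  fixes n :: nat and G :: "nat graph"
  assumes "simple_graph G" and "verts G = {1..n}" and "connected_graph G"
  shows "(labeled_hamiltonian n G \<longrightarrow>
           (almost_complete_intersection (hankel_ring n :: ('k::field) mpoly ring)
              (hankel_edge_ideal n G) \<longleftrightarrow> G = cycle_graph n)) \<and>
         (labeled_semi_hamiltonian n G \<longrightarrow>
           (almost_complete_intersection (hankel_ring n :: 'k mpoly ring)
              (hankel_edge_ideal n G) \<longleftrightarrow>
            unicyclic G \<and>
            (\<exists>t s. 1 \<le> t \<and> t + 2 \<le> n \<and> 2 \<le> s \<and>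
               G = (verts (path_graph n), insert {t, t + s} (edges (path_graph n))))))"
proof (intro conjI impI)
  have "verts G \<noteq> {}" using assms(3) by (simp add: connected_graph_def)
  hence n: "1 \<le> n" using assms(2) by simp
  \<comment> \<open>The height n - 1 plus one is n because 1 \<le> n, so truncated subtraction does
    no harm.\<close>
  have aci: "almost_complete_intersection (hankel_ring n :: 'k mpoly ring) (hankel_edge_ideal n G)
      \<longleftrightarrow> card (edges G) = n" if "subgraph (path_graph n) G"
    unfolding almost_complete_intersection_def
      num_min_gens_hankel_edge_ideal[OF assms(1,2)]
      ideal_height_hankel_edge_ideal[OF assms(1,2) n that]
    using n by (simp add: one_enat_def)
  show "almost_complete_intersection (hankel_ring n :: 'k mpoly ring) (hankel_edge_ideal n G)
      \<longleftrightarrow> G = cycle_graph n" if "labeled_hamiltonian n G"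
  proof -
    have "subgraph (path_graph n) G"
      using that by (auto simp: labeled_hamiltonian_def subgraph_def cycle_graph_eq path_graph_def)
    thus ?thesis using aci hamiltonian_card_edges_iff[OF assms(1,2) that] by simp
  qed
  assume "labeled_semi_hamiltonian n G"
  hence sub: "subgraph (path_graph n) G" by (simp add: labeled_semi_hamiltonian_def)
  have V: "verts (path_graph n) = {1..n}" by (simp add: path_graph_def)
  let ?G = "\<lambda>t s. (verts (path_graph n), insert {t, t + s} (edges (path_graph n)))"
  have uni: "unicyclic G" if "1 \<le> t" "2 \<le> s" "t + s \<le> n" "G = ?G t s" for t s
    using that unicyclic_path_with_chord[of t "t + s" n] unfolding V by simp
  \<comment> \<open>The statement bounds t but not t + s; the bound comes from the edge having its
    ends among the vertices.\<close>
  have le: "t + s \<le> n" if "G = ?G t s" for t s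
  proof -
    have "{t, t + s} \<in> edges G" by (subst that) simp
    from simple_graph_edgeD[OF assms(1) this] show ?thesis unfolding assms(2) by simp
  qed
  show "almost_complete_intersection (hankel_ring n :: 'k mpoly ring) (hankel_edge_ideal n G)
      \<longleftrightarrow> unicyclic G \<and> (\<exists>t s. 1 \<le> t \<and> t + 2 \<le> n \<and> 2 \<le> s \<and> G = ?G t s)"
    unfolding aci[OF sub] semi_hamiltonian_card_edges_iff[OF assms(1,2) n sub]
    using uni le by blast
qed

end
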